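(* For $|q|<1$ and every real $\nu$, \begin{align*} \sum_{i,j,k\geq 0} \frac{q^{i^2+j^2+k^2+ij+ik+\nu(j-k)}}{(q;q)_i(q;q)_j(q;q)_k} &=\frac{(-q^{1+\nu},-q^{1-\nu},q^2;q^2)_\infty}{(q;q)_\infty}, \\ \sum_{i,j,k\geq 0}\frac{q^{i^2+j^2+k^2+ij+ik+i+j}}{(q;q)_i(q;q)_j(q;q)_k}&=\frac{(q^4;q^4)_\infty^2}{(q;q)_\infty (q^2;q^2)_\infty}, \\ \sum_{i,j,k\geq 0}\frac{q^{2i^2+2j^2+2k^2+2ij+2ik+i+2k}}{(q^2;q^2)_i(q^2;q^2)_j(q^2;q^2)_k}&=\frac{(q,q^5,q^6;q^6)_\infty}{(q;q)_\infty}, \\ \sum_{i,j,k\geq 0}\frac{q^{2i^2+2j^2+2k^2+2ij+2ik-i}}{(q^2;q^2)_i(q^2;q^2)_j(q^2;q^2)_k}&=\frac{(q^3;q^3)_\infty^2}{(q;q)_\infty (q^6;q^6)_\infty},\\ \sum_{i,j,k\geq 0}\frac{q^{2i^2+2j^2+2k^2+2ij+2ik-2i-j-k}}{(q^2;q^2)_i(q^2;q^2)_j(q^2;q^2)_k}&=2\frac{(q^2;q^2)_\infty}{(q;q)_\infty}. \end{align*}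
   Context: For $|q|<1$: $(a;q)_n=\prod_{k=0}^{n-1}(1-aq^k)$ ($(a;q)_0=1$), $(a;q)_\infty=\prod_{k\ge0}(1-aq^k)$, $(a_1,\dots,a_m;q)_\infty=\prod_\ell(a_\ell;q)_\infty$. Real powers $q^{x}$ are defined as $e^{x\log q}$ for a fixed choice of $\log q$ (e.g. $0<q<1$). *)

theory Defs
  imports "HOL-Analysis.Analysis"
begin

definition qpoch :: "complex \<Rightarrow> complex \<Rightarrow> nat \<Rightarrow> complex" where
  "qpoch a q n = (\<Prod>k<n. 1 - a * q ^ k)"

definition qpoch_inf :: "complex \<Rightarrow> complex \<Rightarrow> complex" where
  "qpoch_inf a q = (\<Prod>k. 1 - a * q ^ k)"

text \<open>Real power q^x := exp(x * L), where L is a fixed logarithm of q (exp L = q).\<close>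
definition qpow :: "complex \<Rightarrow> real \<Rightarrow> complex" where
  "qpow L x = exp (of_real x * L)"

end

theory Submission
  imports Defs
begin

text \<open>
  All sums are taken over integer indices, with 1 / (q; q)_n read as 0 for n < 0, so that reindexing is a
  linear substitution. The single tool is the limiting q-Vandermonde identity
    sum_i q^{(a-i)(b-i)} / ((q)_i (q)_{a-i} (q)_{b-i}) = 1 / ((q)_a (q)_b),
  whose limit a, b \<rightarrow> \<infinity> is the Durfee identity sum_m q^{m(m+n)} / ((q)_m (q)_{m+n}) = 1 / (q)_\<infinity>;
  the latter and Euler's series give the Jacobi triple product.

  With a = i + k and b = i + j the triple sum with weight u^{i+k} v^{i+j} collapses to
  G(u, v) = sum_{a,b} q^{a^2-ab+b^2} u^a v^b / ((q)_a (q)_b). Summing along b - a = n gives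
  G(1/z, z) = sum_n q^{n^2} z^n / (q)_\<infinity>, which is the first identity. The recurrence
  G(u, v) = G(uq, v) + uq G(uq^2, v/q) reduces the second and the fifth identity to this case.

  In the third and fourth identity (base q^2) the exponent contains (i+j+k)^2 + i^2 + (j-k)^2. Expanding
  1 / ((q^2)_j (q^2)_k) by q-Vandermonde gives a fourfold sum, which regroups to Bressoud's double sum
  sum_{s,R} q^{(s+R)^2+s^2+e(2s+R)} / ((q^2; q^2)_s (q; q)_R) with e = 1 and e = 0 respectively. This is
  summed by the Bailey chain that starts from Gauss's
  sum_r (-1)^r q^{r^2} / ((q)_{s-r} (q)_{s+r+e}) = 1 / (q^2; q^2)_s.
\<close>

subsection \<open>q-Pochhammer symbols\<close>

lemma qpoch_0 [simp]: "qpoch a q 0 = 1"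
  by (simp add: qpoch_def)

lemma qpoch_Suc: "qpoch a q (Suc n) = qpoch a q n * (1 - a * q ^ n)"
  by (simp add: qpoch_def)

lemma power_Suc_neq_1:
  fixes q :: complex
  assumes "norm q < 1"
  shows "q ^ Suc n \<noteq> 1"
proof
  assume "q ^ Suc n = 1"
  hence "norm q ^ Suc n = 1" by (metis norm_one norm_power)
  moreover have "norm q ^ Suc n < 1" using assms by (subst power_less_one_iff) auto
  ultimately show False by simp
qed

lemma qpoch_nonzero: "norm q < 1 \<Longrightarrow> qpoch q q n \<noteq> 0"
  using power_Suc_neq_1[of q] by (auto simp: qpoch_def)

lemma convergent_qpoch:
  fixes a q :: complex
  assumes "norm q < 1"
  shows "convergent_prod (\<lambda>k. 1 - a * q ^ k)"
proof -
  have "summable (\<lambda>k. norm (a * q ^ k))"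
    unfolding norm_mult norm_power using assms by (intro summable_mult summable_geometric) auto
  hence "abs_convergent_prod (\<lambda>k. 1 + (- (a * q ^ k)))"
    by (intro summable_imp_abs_convergent_prod) simp
  thus ?thesis by (simp add: abs_convergent_prod_imp_convergent_prod)
qed

lemma qpoch_LIMSEQ:
  assumes "norm q < 1"
  shows "qpoch a q \<longlonglongrightarrow> qpoch_inf a q"
proof -
  have "(\<lambda>n. qpoch a q (Suc n)) \<longlonglongrightarrow> qpoch_inf a q"
    using convergent_prod_LIMSEQ[OF convergent_qpoch[OF assms]]
    by (simp add: qpoch_def qpoch_inf_def lessThan_Suc_atMost)
  thus ?thesis by (rule LIMSEQ_imp_Suc)
qed

lemma qpoch_inf_nonzero:
  assumes "norm q < 1"
  shows "qpoch_inf q q \<noteq> 0"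
  unfolding qpoch_inf_def
  by (intro prodinf_nonzero convergent_qpoch assms) (use power_Suc_neq_1[OF assms] in auto)

text \<open>The factors with even and odd exponent are separated in the finite product of length 2n,
  and the limit carries the identity over. The next two lemmas follow the same pattern.\<close>

lemma qpoch_inf_split_parity:
  assumes "norm q < 1"
  shows "qpoch_inf a q = qpoch_inf a (q^2) * qpoch_inf (a * q) (q^2)"
proof -
  have q2: "norm (q^2) < 1" using assms by (simp add: norm_power power_less_one_iff)
  have fin: "qpoch a q (2*n) = qpoch a (q^2) n * qpoch (a * q) (q^2) n" for n
    by (induction n) (simp_all add: qpoch_Suc power_mult[symmetric])
  have "(\<lambda>n. qpoch a q (2*n)) \<longlonglongrightarrow> qpoch_inf a q"
    using LIMSEQ_subseq_LIMSEQ[OF qpoch_LIMSEQ[OF assms], of "\<lambda>n. 2*n"]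
    by (simp add: strict_mono_def o_def)
  moreover have "(\<lambda>n. qpoch a q (2*n)) \<longlonglongrightarrow> qpoch_inf a (q^2) * qpoch_inf (a * q) (q^2)"
    unfolding fin by (intro tendsto_mult qpoch_LIMSEQ q2)
  ultimately show ?thesis by (rule LIMSEQ_unique)
qed

lemma qpoch_inf_mult_uminus:
  assumes "norm q < 1"
  shows "qpoch_inf a q * qpoch_inf (- a) q = qpoch_inf (a^2) (q^2)"
proof -
  have q2: "norm (q^2) < 1" using assms by (simp add: norm_power power_less_one_iff)
  have fin: "qpoch a q n * qpoch (- a) q n = qpoch (a^2) (q^2) n" for n
    by (induction n)
       (simp_all add: qpoch_Suc power_mult[symmetric] algebra_simps power2_eq_square power_add mult_2)
  have "(\<lambda>n. qpoch a q n * qpoch (- a) q n) \<longlonglongrightarrow> qpoch_inf a q * qpoch_inf (- a) q"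
    by (intro tendsto_mult qpoch_LIMSEQ assms)
  moreover have "(\<lambda>n. qpoch a q n * qpoch (- a) q n) \<longlonglongrightarrow> qpoch_inf (a^2) (q^2)"
    unfolding fin by (intro qpoch_LIMSEQ q2)
  ultimately show ?thesis by (rule LIMSEQ_unique)
qed

lemma qpoch_inf_rec:
  assumes "norm q < 1"
  shows "qpoch_inf a q = (1 - a) * qpoch_inf (a * q) q"
proof -
  have fin: "qpoch a q (Suc n) = (1 - a) * qpoch (a * q) q n" for n
    by (induction n) (simp_all add: qpoch_Suc)
  have "(\<lambda>n. qpoch a q (Suc n)) \<longlonglongrightarrow> qpoch_inf a q"
    by (intro LIMSEQ_Suc qpoch_LIMSEQ assms)
  moreover have "(\<lambda>n. qpoch a q (Suc n)) \<longlonglongrightarrow> (1 - a) * qpoch_inf (a * q) q"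
    unfolding fin by (intro tendsto_mult tendsto_const qpoch_LIMSEQ assms)
  ultimately show ?thesis by (rule LIMSEQ_unique)
qed

section \<open>Reciprocals of (q; q)_n over all integers\<close>

definition rqp :: "complex \<Rightarrow> int \<Rightarrow> complex" where
  "rqp q n = (if n < 0 then 0 else 1 / qpoch q q (nat n))"

lemma rqp_neg [simp]: "n < 0 \<Longrightarrow> rqp q n = 0"
  by (simp add: rqp_def)

lemma rqp_0 [simp]: "rqp q 0 = 1"
  by (simp add: rqp_def)

lemma rqp_of_nat: "rqp q (int n) = 1 / qpoch q q n"
  by (simp add: rqp_def)

text \<open>At n = 0 the factor 1 - q^0 vanishes together with \<open>rqp q (- 1)\<close>, so
  extension by zero makes the recurrence hold on all integers. Later index recurrences follow from
  it without boundary terms.\<close>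

lemma rqp_rec:
  assumes "norm q < 1"
  shows "(1 - q powi n) * rqp q n = rqp q (n - 1)"
proof (cases "n \<ge> 1")
  case True
  define m where "m = nat (n - 1)"
  have m: "n = int (Suc m)" using True by (simp add: m_def)
  have "1 - q ^ Suc m \<noteq> 0" using power_Suc_neq_1[OF assms, of m] by auto
  thus ?thesis using m qpoch_nonzero[OF assms, of m]
    by (simp add: rqp_def qpoch_Suc nat_add_distrib power_int_def del: of_nat_Suc) (simp add: rqp_def)
next
  case False
  thus ?thesis by (cases "n = 0") auto
qed

lemma rqp_tendsto:
  assumes "norm q < 1"
  shows "(\<lambda>n. rqp q (int n + k)) \<longlonglongrightarrow> 1 / qpoch_inf q q"
proof -
  have "(\<lambda>n. rqp q (int n)) \<longlonglongrightarrow> 1 / qpoch_inf q q"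
    unfolding rqp_of_nat by (intro tendsto_divide tendsto_const qpoch_LIMSEQ qpoch_inf_nonzero assms)
  moreover have "filterlim (\<lambda>n. nat (int n + k)) sequentially sequentially"
    unfolding filterlim_at_top
  proof
    fix Z
    show "\<forall>\<^sub>F n in sequentially. Z \<le> nat (int n + k)"
      using eventually_ge_at_top[of "Z + nat (- k)"] by eventually_elim linarith
  qed
  ultimately have "(\<lambda>n. rqp q (int (nat (int n + k)))) \<longlonglongrightarrow> 1 / qpoch_inf q q"
    by (rule filterlim_compose)
  moreover have "\<forall>\<^sub>F n in sequentially. rqp q (int (nat (int n + k))) = rqp q (int n + k)"
    using eventually_ge_at_top[of "nat (- k)"] by eventually_elim auto
  ultimately show ?thesis by (rule Lim_transform_eventually)
qed

text \<open>A convergent sequence is bounded. The uniform bound reduces summability below to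
  estimates for powers of q and the weights.\<close>

lemma rqp_bounded:
  assumes "norm q < 1"
  obtains K where "K > 0" "\<And>n. norm (rqp q n) \<le> K"
proof -
  have "Bseq (\<lambda>n. rqp q (int n + 0))"
    using rqp_tendsto[OF assms] by (intro convergent_imp_Bseq convergentI)
  then obtain K where K: "K > 0" "\<And>n. norm (rqp q (int n)) \<le> K"
    unfolding Bseq_def by auto
  have "norm (rqp q n) \<le> K" for n
    using K(1) K(2)[of "nat n"] by (cases "n < 0") auto
  with K(1) show ?thesis by (rule that)
qed

subsection \<open>Summation over integer tuples\<close>

text \<open>Fubini with summability of the whole family as a premise: only the inner sums remain to
  be evaluated. Multiple sums are collapsed below by a bijective reindexing, where one is called
  for, followed by this lemma.\<close>

lemma has_sum_collapse:
  fixes f :: "'a \<times> 'b \<Rightarrow> complex"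
  assumes "(f has_sum S) UNIV" "\<And>x. ((\<lambda>y. f (x, y)) has_sum g x) UNIV"
  shows "(g has_sum S) UNIV"
  using has_sum_SigmaD[where f = f and S = S and A = UNIV and B = "\<lambda>_. UNIV" and g = g] assms by simp

lemma has_sum_reindex_bij:
  assumes "(f has_sum S) UNIV" "\<And>x. i (j x) = x" "\<And>x. j (i x) = x" "\<And>x. g x = f (j x)"
  shows "(g has_sum S) UNIV"
  using assms(1) by (subst has_sum_reindex_bij_witness[of UNIV i j UNIV f g S S]) (use assms in auto)

lemma has_sum_int_support:
  assumes "\<And>n. n < 0 \<Longrightarrow> f n = 0"
  shows "(f has_sum S) UNIV \<longleftrightarrow> ((\<lambda>n. f (int n)) has_sum S) UNIV"
proof -
  have "(f has_sum S) UNIV \<longleftrightarrow> (f has_sum S) (range int)"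
    using assms by (intro has_sum_cong_neutral) (auto simp: image_iff, metis nonneg_int_cases not_less)
  thus ?thesis by (simp add: has_sum_reindex o_def)
qed

lemma summable_on_product_nonneg:
  fixes f :: "'a \<Rightarrow> real" and g :: "'b \<Rightarrow> real"
  assumes "f summable_on UNIV" "g summable_on UNIV" "\<And>x. f x \<ge> 0" "\<And>x. g x \<ge> 0"
  shows "(\<lambda>(x, y). f x * g y) summable_on UNIV"
proof -
  have "(\<lambda>(x, y). f x * g y) summable_on Sigma UNIV (\<lambda>_. UNIV)"
    by (rule summable_on_SigmaI[where g = "\<lambda>x. f x * infsum g UNIV"])
       (use assms in \<open>auto intro!: has_sum_cmult_right summable_on_cmult_left\<close>)
  thus ?thesis by simp
qed

section \<open>Theta series as majorants\<close>

lemma summable_theta_nat: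
  fixes r c :: real
  assumes "0 < r" "r < 1" "0 < c"
  shows "summable (\<lambda>n. r ^ (n^2) * c ^ n)"
proof -
  \<comment> \<open>Consecutive terms have the quotient r^(n+1) * (r^n * c), and r^n * c eventually
    falls below 1/2, however large c is.\<close>
  have "(\<lambda>n. r ^ n * (c * 1)) \<longlonglongrightarrow> 0 * (c * 1)"
    using assms by (intro tendsto_mult LIMSEQ_power_zero tendsto_const) auto
  hence "\<forall>\<^sub>F n in sequentially. r ^ n * c < 1/2"
    by (intro order_tendstoD(2)[of _ 0]) auto
  then obtain N where N: "\<And>n. n \<ge> N \<Longrightarrow> r ^ n * c < 1/2"
    by (auto simp: eventually_sequentially)
  show ?thesis
  proof (rule summable_ratio_test[of "1/2" N])
    fix n assume n: "n \<ge> N"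
    have e: "(Suc n)^2 = n^2 + n + Suc n" by (simp add: power2_eq_square)
    have "r ^ (Suc n)^2 * c ^ Suc n = (r ^ n^2 * c ^ n) * (r ^ Suc n * (r ^ n * c))"
      unfolding e power_add by (simp add: mult_ac)
    also have "\<dots> \<le> (r ^ n^2 * c ^ n) * (1 * (1/2))"
      using assms N[OF n] by (intro mult_left_mono mult_mono power_le_one) auto
    finally show "norm (r ^ (Suc n)^2 * c ^ Suc n) \<le> 1/2 * norm (r ^ n^2 * c ^ n)"
      using assms by (simp add: abs_mult)
  qed simp
qed

text \<open>Term of a two-sided theta series, the common majorant. Quadratic decay beats the weight
  c in both directions, so linear terms of either sign in an exponent can be moved into c.\<close>

definition theta_term :: "real \<Rightarrow> real \<Rightarrow> int \<Rightarrow> real" where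
  "theta_term r c x = r powi (x^2) * c powi x"

lemma theta_term_nonneg: "0 < r \<Longrightarrow> 0 < c \<Longrightarrow> 0 \<le> theta_term r c x"
  by (simp add: theta_term_def)

lemma theta_term_of_nat: "theta_term r c (int n) = r ^ (n^2) * c ^ n"
  unfolding theta_term_def by (metis of_nat_power power_int_of_nat)

lemma theta_term_minus: "theta_term r c (- x) = theta_term r (inverse c) x"
  by (simp add: theta_term_def power_int_minus power_int_inverse)

text \<open>The negative half-line is the positive one with c replaced by 1/c.\<close>

lemma summable_theta_term:
  assumes "0 < r" "r < 1" "0 < c"
  shows "theta_term r c summable_on UNIV"
proof -
  have half: "theta_term r c summable_on range int" if "0 < c" for c
    using summable_theta_nat[OF assms(1,2) that] assms that
    by (subst summable_on_reindex)
       (auto simp: o_def theta_term_of_nat intro!: summable_nonneg_imp_summable_on)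
  have "theta_term r c summable_on uminus ` range int"
    using half[of "inverse c"] assms
    by (subst summable_on_reindex) (auto simp: o_def theta_term_minus inj_on_def)
  hence "theta_term r c summable_on range int \<union> uminus ` range int"
    by (intro summable_on_union half assms)
  also have "range int \<union> uminus ` range int = UNIV"
    by (auto simp: image_iff) (metis int_cases2)
  finally show ?thesis .
qed

lemma summable_on_theta_bound:
  fixes f :: "'a \<Rightarrow> complex"
  assumes "g summable_on UNIV" "\<And>x. norm (f x) \<le> C * g x"
  shows "f summable_on UNIV"
  by (rule abs_summable_summable)
     (rule Infinite_Sum.abs_summable_on_comparison_test'[OF summable_on_cmult_right[OF assms(1)] assms(2)])

lemma summable_theta_term2:
  assumes "0 < r" "r < 1" "0 < c" "0 < d"
  shows "(\<lambda>(x, y). theta_term r c x * theta_term r d y) summable_on UNIV"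
  using assms by (intro summable_on_product_nonneg summable_theta_term theta_term_nonneg)

lemma summable_theta_term3:
  assumes "0 < r" "r < 1" "0 < c" "0 < d" "0 < e"
  shows "(\<lambda>(x, y, z). theta_term r c x * (theta_term r d y * theta_term r e z)) summable_on UNIV"
  using summable_on_product_nonneg[OF summable_theta_term[of r c] summable_theta_term2[of r d e]] assms
  by (auto simp: case_prod_unfold theta_term_nonneg)

lemma summable_theta_term4:
  assumes "0 < r" "r < 1" "0 < b" "0 < c" "0 < d" "0 < e"
  shows "(\<lambda>(w, x, y, z). theta_term r b w * (theta_term r c x * (theta_term r d y * theta_term r e z)))
           summable_on UNIV"
  using summable_on_product_nonneg[OF summable_theta_term[of r b] summable_theta_term3[of r c d e]] assms
  by (auto simp: case_prod_unfold theta_term_nonneg)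

subsection \<open>The q-Vandermonde, Durfee and Jacobi identities\<close>

text \<open>Induction on a. Both sides satisfy (1 - q^a) V(a, b) = V(a-1, b): splitting 1 - q^a = (1
  - q^(a-i)) + q^(a-i) (1 - q^i) lowers a in each summand, and after a shift of i the two resulting
  weights q^(b-i) and 1 - q^(b-i) add up to 1.\<close>

lemma has_sum_q_vandermonde:
  fixes q :: complex
  assumes q: "norm q < 1" "q \<noteq> 0"
  shows "((\<lambda>i. q powi ((a - i) * (b - i)) * rqp q i * rqp q (a - i) * rqp q (b - i))
            has_sum rqp q a * rqp q b) UNIV"
proof (cases "a < 0")
  case True
  have "rqp q i = 0 \<or> rqp q (a - i) = 0" for i using True by (cases "i < 0") auto
  hence "(\<lambda>i. q powi ((a - i) * (b - i)) * rqp q i * rqp q (a - i) * rqp q (b - i)) = (\<lambda>_. 0)"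
    by (intro ext) (metis mult_zero_left mult_zero_right)
  thus ?thesis using True by simp
next
  case False
  define v where "v a b i = q powi ((a - i) * (b - i)) * rqp q i * rqp q (a - i) * rqp q (b - i)" for a b i
  have v_rec: "(1 - q powi a) * v a b i =
      q powi (b - i) * v (a - 1) b i + (1 - q powi (b - (i - 1))) * v (a - 1) b (i - 1)" for a b i
  proof -
    have "(1 - q powi a) * v a b i = q powi ((a-i)*(b-i)) * rqp q i * ((1 - q powi (a-i)) * rqp q (a-i)) * rqp q (b-i)
        + q powi ((a-i)*(b-i)) * q powi (a - i) * ((1 - q powi i) * rqp q i) * rqp q (a-i) * rqp q (b-i)"
      using q power_int_add[of q "a - i" i] by (simp add: v_def algebra_simps)
    \<comment> \<open>In the second part \<open>rqp q (b - i)\<close> is raised to index b - (i - 1)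
      at the cost of the factor 1 - q^(b-(i-1)); this makes it a term of \<open>v (a - 1) b\<close>
      at i - 1.\<close>
    also have "\<dots> = q powi ((a-i)*(b-i)) * rqp q i * rqp q (a - 1 - i) * rqp q (b-i)
        + q powi ((a-i)*(b-i)) * q powi (a - i) * rqp q (i - 1) * rqp q (a-i)
          * ((1 - q powi (b - (i - 1))) * rqp q (b - (i - 1)))"
      unfolding rqp_rec[OF q(1)] by (simp add: algebra_simps)
    also have "q powi ((a-i)*(b-i)) = q powi (b - i) * q powi ((a - 1 - i)*(b-i))"
      using q by (subst power_int_add[symmetric]) (auto simp: algebra_simps)
    also have "q powi (b - i) * q powi ((a - 1 - i)*(b-i)) * q powi (a - i) = q powi ((a - 1 - (i - 1))*(b-(i - 1)))"
      using q by (simp add: power_int_add[symmetric]) (auto simp: algebra_simps)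
    finally show ?thesis by (simp add: v_def algebra_simps)
  qed
  have "(v (int n) b has_sum rqp q (int n) * rqp q b) UNIV" for n b
  proof (induction n)
    case 0
    have "v 0 b x = 0" if "x \<noteq> 0" for x using that by (cases "x < 0") (auto simp: v_def)
    thus ?case by (intro has_sum_finite_neutralI[of "{0}"]) (auto simp: v_def)
  next
    case (Suc n)
    define f where "f = v (int n) b"
    have f: "(f has_sum rqp q (int n) * rqp q b) UNIV" using Suc by (simp add: f_def)
    \<comment> \<open>The support is finite, so the weighted sum has some value S. It enters once
      with each sign and cancels.\<close>
    have "(\<lambda>i. q powi (b - i) * f i) summable_on UNIV"
    proof (rule finite_nonzero_values_imp_summable_on)
      have "{x. q powi (b - x) * f x \<noteq> 0} \<subseteq> {0..int n}"
        by (auto simp: f_def v_def rqp_def split: if_splits)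
      thus "finite {x \<in> UNIV. q powi (b - x) * f x \<noteq> 0}"
        by (auto intro: finite_subset)
    qed
    then obtain S where S: "((\<lambda>i. q powi (b - i) * f i) has_sum S) UNIV"
      by (auto simp: summable_on_def)
    have "((\<lambda>i. f i - q powi (b - i) * f i) has_sum (rqp q (int n) * rqp q b - S)) UNIV"
      using has_sum_add[OF f has_sum_uminusI[OF S]] by simp
    hence "((\<lambda>i. (1 - q powi (b - (i - 1))) * f (i - 1)) has_sum (rqp q (int n) * rqp q b - S)) UNIV"
      by (rule has_sum_reindex_bij[of _ _ "\<lambda>i. i + 1" "\<lambda>i. i - 1"]) (auto simp: algebra_simps)
    from has_sum_add[OF S this]
    have "((\<lambda>i. (1 - q powi (int (Suc n))) * v (int (Suc n)) b i) has_sum (rqp q (int n) * rqp q b)) UNIV"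
      by (subst v_rec) (simp add: f_def)
    moreover have nz: "1 - q powi (int (Suc n)) \<noteq> 0"
      using power_Suc_neq_1[OF q(1), of n] by (simp only: power_int_of_nat) auto
    moreover have "rqp q (int n) = (1 - q powi (int (Suc n))) * rqp q (int (Suc n))"
      by (subst rqp_rec[OF q(1)]) simp
    ultimately show ?case using nz by (simp only: mult.assoc has_sum_cmult_right_iff[OF nz]) simp
  qed
  from this[of "nat a" b] False have "(v a b has_sum rqp q a * rqp q b) UNIV" by simp
  thus ?thesis by (simp add: v_def[abs_def])
qed

text \<open>Limit M \<rightarrow> \<infinity> of q-Vandermonde with a = M, b = M + n and i = M - p.
  The right side tends to 1 / (q)_\<infinity>^2, the left side to 1 / (q)_\<infinity> times the
  wanted sum; one factor is cancelled.\<close>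

lemma has_sum_durfee_nat:
  fixes q :: complex
  assumes q: "norm q < 1" "q \<noteq> 0"
  shows "((\<lambda>m. q powi (m * (m + int n)) * rqp q m * rqp q (m + int n)) has_sum 1 / qpoch_inf q q) UNIV"
proof -
  obtain K where K: "K > 0" "\<And>n. norm (rqp q n) \<le> K" using rqp_bounded[OF q(1)] by metis
  \<comment> \<open>The part of the summand that does not depend on M. Since p (p + n) \<ge> p, it
    is dominated by a geometric series, as Tannery's theorem requires.\<close>
  define c where "c p = q ^ (p * (p + n)) * rqp q (int p) * rqp q (int p + int n)" for p
  have cnorm: "norm (c p) \<le> norm q ^ p * (K * K)" for p
  proof -
    have "norm q ^ (p * (p + n)) \<le> norm q ^ p"
      using q by (intro power_decreasing) (cases p; auto)+
    thus ?thesis unfolding c_def norm_mult norm_power mult.assoc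
      by (intro mult_mono K(2)) (use K(1) in auto)
  qed
  have lim: "((\<lambda>M. rqp q (int M - int p) * c p) \<longlonglongrightarrow> 1 / qpoch_inf q q * c p)" for p
    using rqp_tendsto[OF q(1), of "- int p"] by (intro tendsto_mult) auto
  have bound: "norm (rqp q (int M - int p) * c p) \<le> K * (norm q ^ p * (K * K))" for M p
    unfolding norm_mult by (intro mult_mono K(2) cnorm) (use K in auto)
  have summ: "summable (\<lambda>p. K * (norm q ^ p * (K * K)))"
    using q by (intro summable_mult summable_mult2 summable_geometric) auto
  have fin: "(\<Sum>p. rqp q (int M - int p) * c p) = rqp q (int M) * rqp q (int M + int n)" for M
  proof -
    have "((\<lambda>p. q powi (p * (p + int n)) * rqp q (int M - p) * rqp q p * rqp q (p + int n))
        has_sum rqp q (int M) * rqp q (int M + int n)) UNIV"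
      by (rule has_sum_reindex_bij[OF has_sum_q_vandermonde[OF q, of "int M" "int M + int n"],
            where i = "\<lambda>p. int M - p" and j = "\<lambda>p. int M - p"])
         (auto simp: algebra_simps)
    hence "((\<lambda>p. rqp q (int M - int p) * c p) has_sum rqp q (int M) * rqp q (int M + int n)) UNIV"
      by (subst (asm) has_sum_int_support)
         (auto simp: c_def power_int_def nat_mult_distrib nat_add_distrib mult_ac)
    thus ?thesis by (intro sums_unique[symmetric] has_sum_imp_sums)
  qed
  have T: "(\<lambda>M. \<Sum>p. rqp q (int M - int p) * c p) \<longlonglongrightarrow> (\<Sum>p. 1 / qpoch_inf q q * c p)"
    by (rule tannerys_theorem[of "\<lambda>p M. rqp q (int M - int p) * c p", OF lim _ summ, THEN conjunct2, THEN conjunct2])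
       (simp_all add: bound case_prod_unfold)
  have "(\<lambda>M. \<Sum>p. rqp q (int M - int p) * c p) \<longlonglongrightarrow> 1 / qpoch_inf q q * (1 / qpoch_inf q q)"
    unfolding fin using rqp_tendsto[OF q(1), of 0] by (intro tendsto_mult rqp_tendsto q) simp
  from LIMSEQ_unique[OF T this]
  have "(\<Sum>p. 1 / qpoch_inf q q * c p) = 1 / qpoch_inf q q * (1 / qpoch_inf q q)" .
  moreover have csum: "summable (\<lambda>p. norm (c p))"
    by (rule summable_comparison_test'[of "\<lambda>p. norm q ^ p * (K * K)" 0])
       (use q cnorm in \<open>auto intro!: summable_mult2 summable_geometric\<close>)
  ultimately have "1 / qpoch_inf q q * (\<Sum>p. c p) = 1 / qpoch_inf q q * (1 / qpoch_inf q q)"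
    using suminf_mult[of c "1 / qpoch_inf q q"] by (simp add: summable_norm_cancel)
  hence "(\<Sum>p. c p) = 1 / qpoch_inf q q"
    using qpoch_inf_nonzero[OF q(1)] by (simp add: field_simps)
  hence "(c has_sum 1 / qpoch_inf q q) UNIV"
    using norm_summable_imp_has_sum[OF csum] summable_norm_cancel[OF csum] summable_sums by fastforce
  thus ?thesis
    by (subst has_sum_int_support)
       (auto simp: c_def[abs_def] power_int_def nat_mult_distrib nat_add_distrib mult_ac)
qed

text \<open>For n < 0 the shift m \<rightarrow> m + n exchanges the two factors and replaces n by
  -n.\<close>

lemma has_sum_durfee:
  fixes q :: complex
  assumes q: "norm q < 1" "q \<noteq> 0"
  shows "((\<lambda>m. q powi (m * (m + n)) * rqp q m * rqp q (m + n)) has_sum 1 / qpoch_inf q q) UNIV"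
proof (cases "n \<ge> 0")
  case True
  thus ?thesis using has_sum_durfee_nat[OF q, of "nat n"] by simp
next
  case False
  show ?thesis
    by (rule has_sum_reindex_bij[OF has_sum_durfee_nat[OF q, of "nat (-n)"],
          where i = "\<lambda>m. m - n" and j = "\<lambda>m. m + n"])
       (use False in \<open>auto simp: mult_ac\<close>)
qed

lemma norm_square_less_1: "norm q < 1 \<Longrightarrow> norm (q^2 :: complex) < 1"
  by (simp add: norm_power power_less_one_iff)

text \<open>The series f satisfies f(w) = (1 + q w) f(q^2 w). Iterating produces the finite
  products, and the remaining factor f(q^(2n) z) tends to f(0) = 1 by continuity.\<close>

lemma has_sum_euler:
  fixes q z :: complex
  assumes q: "norm q < 1" "q \<noteq> 0" and z: "z \<noteq> 0"
  shows "((\<lambda>n. q ^ (n^2) * z ^ n / qpoch (q^2) (q^2) n) has_sum qpoch_inf (- (q * z)) (q^2)) UNIV"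
proof -
  define c where "c n = q ^ (n^2) / qpoch (q^2) (q^2) n" for n
  define f where "f w = (\<Sum>n. c n * w ^ n)" for w
  note q2 = norm_square_less_1[OF q(1)]
  obtain K where K: "K > 0" "\<And>n. norm (rqp (q^2) n) \<le> K" using rqp_bounded[OF q2] by metis
  have abs_summ: "summable (\<lambda>n. norm (c n * w ^ n))" if "w \<noteq> 0" for w
  proof (rule summable_comparison_test'[of "\<lambda>n. K * (norm q ^ (n^2) * norm w ^ n)" 0])
    show "summable (\<lambda>n. K * (norm q ^ (n^2) * norm w ^ n))"
      using q that by (intro summable_mult summable_theta_nat) auto
    fix n
    have "norm (1 / qpoch (q^2) (q^2) n) \<le> K" using K(2)[of "int n"] by (simp add: rqp_of_nat)
    hence "norm (1 / qpoch (q^2) (q^2) n) * (norm q ^ (n^2) * norm w ^ n) \<le> K * (norm q ^ (n^2) * norm w ^ n)"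
      by (rule mult_right_mono) auto
    thus "norm (norm (c n * w ^ n)) \<le> K * (norm q ^ (n^2) * norm w ^ n)"
      by (simp add: c_def norm_mult norm_divide norm_power)
  qed
  have summ: "summable (\<lambda>n. c n * w ^ n)" for w
    using summable_norm_cancel[OF abs_summ[of w]] by (cases "w = 0") auto
  have f_rec: "f w = (1 + q * w) * f (q^2 * w)" for w
  proof -
    have c_rec: "c (Suc n) * (1 - (q^2) ^ Suc n) = c n * q ^ (2 * n + 1)" for n
    proof -
      have e: "(Suc n)^2 = n^2 + (2 * n + 1)" by (simp add: power2_eq_square)
      have "1 - q\<^sup>2 * (q\<^sup>2) ^ n \<noteq> 0" using power_Suc_neq_1[OF q2, of n] by auto
      thus ?thesis unfolding c_def qpoch_Suc e power_add[of q "n^2"] by simp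
    qed
    have "(\<lambda>n. c n * w ^ n - c n * (q^2 * w) ^ n) sums (f w - f (q^2 * w))"
      unfolding f_def by (intro sums_diff summable_sums summ)
    \<comment> \<open>The constant terms of f(w) and f(q^2 w) cancel, so the summation may start at
      index 1.\<close>
    hence "(\<lambda>n. c (Suc n) * w ^ Suc n - c (Suc n) * (q^2 * w) ^ Suc n) sums (f w - f (q^2 * w))"
      by (subst sums_Suc_iff[of "\<lambda>n. c n * w ^ n - c n * (q^2 * w) ^ n"]) simp
    also have "(\<lambda>n. c (Suc n) * w ^ Suc n - c (Suc n) * (q^2 * w) ^ Suc n) =
                 (\<lambda>n. q * w * (c n * (q^2 * w) ^ n))"
    proof
      fix n
      have "c (Suc n) * w ^ Suc n - c (Suc n) * (q^2 * w) ^ Suc n = c (Suc n) * (1 - (q^2) ^ Suc n) * w ^ Suc n"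
        by (simp add: algebra_simps power_mult_distrib)
      also have "\<dots> = q * w * (c n * (q^2 * w) ^ n)"
        unfolding c_rec by (simp add: power_mult_distrib power_mult power_add)
      finally show "c (Suc n) * w ^ Suc n - c (Suc n) * (q^2 * w) ^ Suc n = q * w * (c n * (q^2 * w) ^ n)" .
    qed
    finally have "(\<lambda>n. q * w * (c n * (q^2 * w) ^ n)) sums (f w - f (q^2 * w))" .
    moreover have "(\<lambda>n. q * w * (c n * (q^2 * w) ^ n)) sums (q * w * f (q^2 * w))"
      unfolding f_def by (intro sums_mult summable_sums summ)
    ultimately have "f w - f (q^2 * w) = q * w * f (q^2 * w)" by (rule sums_unique2)
    thus ?thesis by (simp add: algebra_simps)
  qed
  have iter: "f z = qpoch (- (q * z)) (q^2) n * f ((q^2) ^ n * z)" for n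
  proof (induction n)
    case (Suc n)
    thus ?case by (subst (asm) f_rec) (simp add: qpoch_Suc mult_ac)
  qed simp
  have "f 0 = 1" unfolding f_def powser_zero by (simp add: c_def)
  moreover have "isCont f 0"
    unfolding f_def by (rule isCont_powser[of c 1]) (use summ[of 1] in auto)
  moreover have "(\<lambda>n. (q^2) ^ n * z) \<longlonglongrightarrow> 0 * z"
    by (intro tendsto_mult LIMSEQ_power_zero q2 tendsto_const)
  ultimately have "(\<lambda>n. f ((q^2) ^ n * z)) \<longlonglongrightarrow> 1"
    using isCont_tendsto_compose[of 0 f "\<lambda>n. (q^2) ^ n * z" sequentially] by simp
  hence "(\<lambda>n. qpoch (- (q * z)) (q^2) n * f ((q^2) ^ n * z)) \<longlonglongrightarrow> qpoch_inf (- (q * z)) (q^2) * 1"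
    by (intro tendsto_mult qpoch_LIMSEQ q2)
  hence "(\<lambda>n. f z) \<longlonglongrightarrow> qpoch_inf (- (q * z)) (q^2)"
    unfolding iter[symmetric] by simp
  hence "f z = qpoch_inf (- (q * z)) (q^2)" by (simp add: LIMSEQ_const_iff)
  moreover have "((\<lambda>n. c n * z ^ n) has_sum f z) UNIV"
    using norm_summable_imp_has_sum[OF abs_summ[OF z]] summable_sums[OF summ] by (simp add: f_def)
  ultimately show ?thesis by (simp add: c_def)
qed

lemma norm_theta_term_le:
  fixes q z :: complex
  assumes "norm w \<le> K"
  shows "norm (q powi (n^2) * z powi n * w) \<le> theta_term (norm q) (norm z) n * K"
  unfolding theta_term_def norm_mult norm_power_int using assms by (intro mult_left_mono) auto

text \<open>The product of Euler's series at z and at 1/z is summed along a - b = n. As (b+n)^2 +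
  b^2 = n^2 + 2 b (b+n), the inner sum over b is the Durfee sum in base q^2.\<close>

theorem has_sum_jacobi_triple:
  fixes q z :: complex
  assumes q: "norm q < 1" "q \<noteq> 0" and z: "z \<noteq> 0"
  shows "((\<lambda>n. q powi (n^2) * z powi n) has_sum
          qpoch_inf (- (q * z)) (q^2) * qpoch_inf (- (q / z)) (q^2) * qpoch_inf (q^2) (q^2)) UNIV"
proof -
  note q2 = norm_square_less_1[OF q(1)]
  obtain K where K: "K > 0" "\<And>n. norm (rqp (q^2) n) \<le> K" using rqp_bounded[OF q2] by metis
  define t where "t w n = q powi (n^2) * w powi n * rqp (q^2) n" for w n
  have euler: "(t w has_sum qpoch_inf (- (q * w)) (q^2)) UNIV" if "w \<noteq> 0" for w
  proof (subst has_sum_int_support)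
    show "((\<lambda>n. t w (int n)) has_sum qpoch_inf (- (q * w)) (q\<^sup>2)) UNIV"
      using has_sum_euler[OF q that]
      by (simp add: t_def rqp_of_nat power_int_def nat_power_eq)
  qed (simp add: t_def)
  have "(\<lambda>(a, b). t z a * t (1 / z) b) summable_on UNIV"
  proof (rule summable_on_theta_bound[OF summable_theta_term2[of "norm q" "norm z" "norm (1/z)"]])
    fix x :: "int \<times> int"
    obtain a b where x: "x = (a, b)" by (cases x)
    have "norm (t w n) \<le> theta_term (norm q) (norm w) n * K" for w n
      unfolding t_def by (intro norm_theta_term_le K(2))
    hence "norm (t z a * t (1 / z) b) \<le>
            theta_term (norm q) (norm z) a * K * (theta_term (norm q) (norm (1/z)) b * K)"
      unfolding norm_mult[of "t z a"]
      by (intro mult_mono) (use K(1) q z in \<open>auto simp: theta_term_nonneg\<close>)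
    thus "norm (case x of (a, b) \<Rightarrow> t z a * t (1 / z) b) \<le>
        K * K * (case x of (x, y) \<Rightarrow> theta_term (norm q) (norm z) x * theta_term (norm q) (norm (1/z)) y)"
      by (simp add: x mult_ac)
  qed (use q z in auto)
  then obtain S where S: "((\<lambda>(a, b). t z a * t (1 / z) b) has_sum S) UNIV"
    by (auto simp: summable_on_def)
  \<comment> \<open>First evaluation of the double sum: by rows, as a product of two Euler
    series.\<close>
  have "((\<lambda>a. t z a * qpoch_inf (- (q / z)) (q^2)) has_sum S) UNIV"
    using euler[of "1 / z"] z by (intro has_sum_collapse[OF S]) (auto intro!: has_sum_cmult_right)
  moreover have "((\<lambda>a. t z a * qpoch_inf (- (q / z)) (q^2)) has_sum
                   qpoch_inf (- (q * z)) (q^2) * qpoch_inf (- (q / z)) (q^2)) UNIV"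
    by (intro has_sum_cmult_left euler z)
  ultimately have S_eq: "S = qpoch_inf (- (q * z)) (q^2) * qpoch_inf (- (q / z)) (q^2)"
    by (rule has_sum_unique)
  \<comment> \<open>Second evaluation: along the diagonals a - b = n.\<close>
  have "((\<lambda>(n, b). t z (b + n) * t (1 / z) b) has_sum S) UNIV"
    by (rule has_sum_reindex_bij[OF S, where j = "\<lambda>(n, b). (b + n, b)" and i = "\<lambda>(a, b). (a - b, b)"]) auto
  hence "((\<lambda>n. q powi (n^2) * z powi n * (1 / qpoch_inf (q^2) (q^2))) has_sum S) UNIV"
  proof (rule has_sum_collapse)
    fix n
    have "t z (b + n) * t (1 / z) b =
        q powi (n^2) * z powi n * ((q^2) powi (b * (b + n)) * rqp (q^2) b * rqp (q^2) (b + n))" for b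
    proof -
      have "(q^2) powi (b * (b + n)) = q powi (2 * (b * (b + n)))"
        by (simp add: power_int_mult)
      moreover have "q powi ((b + n)^2) * q powi (b^2) = q powi (n^2) * q powi (2 * (b * (b + n)))"
        using q by (simp add: power_int_add[symmetric] power2_eq_square algebra_simps)
      moreover have "z powi (b + n) * (1 / z) powi b = z powi n"
        using z by (simp add: power_int_add power_int_divide_distrib)
      ultimately show ?thesis by (simp add: t_def mult_ac)
    qed
    thus "((\<lambda>b. case (n, b) of (n, b) \<Rightarrow> t z (b + n) * t (1 / z) b) has_sum
             q powi (n^2) * z powi n * (1 / qpoch_inf (q^2) (q^2))) UNIV"
      using q by (simp only: prod.case) (intro has_sum_cmult_right has_sum_durfee q2; simp)
  qed
  hence "((\<lambda>n. q powi (n^2) * z powi n * (1 / qpoch_inf (q^2) (q^2)) * qpoch_inf (q^2) (q^2))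
           has_sum S * qpoch_inf (q^2) (q^2)) UNIV"
    by (rule has_sum_cmult_left)
  thus ?thesis using qpoch_inf_nonzero[OF q2] by (simp add: S_eq)
qed

subsection \<open>The pair sums G(u, v)\<close>

lemma has_sum_int3_support:
  assumes "\<And>i j k. i < 0 \<or> j < 0 \<or> k < 0 \<Longrightarrow> f (i, j, k) = 0"
  shows "(f has_sum S) UNIV \<longleftrightarrow> ((\<lambda>(i, j, k). f (int i, int j, int k)) has_sum S) UNIV"
proof -
  define g where "g = (\<lambda>(i, j, k). (int i, int j, int k))"
  have g: "inj g" by (auto simp: inj_def g_def)
  have "f x = 0" if "x \<notin> range g" for x
  proof -
    obtain i j k where x: "x = (i, j, k)" by (cases x)
    have "i < 0 \<or> j < 0 \<or> k < 0"
    proof (rule ccontr)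
      assume "\<not> ?thesis"
      hence "x = g (nat i, nat j, nat k)" by (simp add: x g_def)
      with that show False by blast
    qed
    with assms show ?thesis by (auto simp: x)
  qed
  hence "(f has_sum S) UNIV \<longleftrightarrow> (f has_sum S) (range g)"
    by (intro has_sum_cong_neutral) auto
  also have "\<dots> \<longleftrightarrow> ((\<lambda>(i, j, k). f (int i, int j, int k)) has_sum S) UNIV"
    by (subst has_sum_reindex[OF g]) (simp add: o_def g_def case_prod_unfold)
  finally show ?thesis .
qed

text \<open>Covers three of the identities: (u, v) = (1/z, z) with z = q^\<nu> for the first, (1, q)
  for the second, and (1/q, 1/q) in base q^2 for the fifth.\<close>

definition nahm_term :: "complex \<Rightarrow> complex \<Rightarrow> complex \<Rightarrow> int \<times> int \<times> int \<Rightarrow> complex" where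
  "nahm_term q u v = (\<lambda>(i, j, k). q powi (i^2 + j^2 + k^2 + i * j + i * k) * u powi (i + k) * v powi (i + j)
      * (rqp q i * rqp q j * rqp q k))"

definition pair_term :: "complex \<Rightarrow> complex \<Rightarrow> complex \<Rightarrow> int \<times> int \<Rightarrow> complex" where
  "pair_term q u v = (\<lambda>(a, b). q powi (a^2 - a * b + b^2) * u powi a * v powi b * (rqp q a * rqp q b))"

lemma power_int_antimono:
  fixes r :: real
  assumes "0 < r" "r < 1" "m \<le> n"
  shows "r powi n \<le> r powi m"
proof -
  have "r powi n = r powi m * r powi (n - m)" using assms by (simp add: power_int_add[symmetric])
  also have "\<dots> \<le> r powi m * 1" using assms by (intro mult_left_mono power_int_le_one) auto
  finally show ?thesis by simp
qed

text \<open>On the support all indices are nonnegative, so the mixed terms ij and ik only decrease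
  the summand. Without them the majorant factors into theta series with weights uv, v and u.\<close>

lemma summable_nahm_term:
  fixes q u v :: complex
  assumes q: "norm q < 1" "q \<noteq> 0" and uv: "u \<noteq> 0" "v \<noteq> 0"
  shows "nahm_term q u v summable_on UNIV"
proof -
  obtain K where K: "K > 0" "\<And>n. norm (rqp q n) \<le> K" using rqp_bounded[OF q(1)] by metis
  show ?thesis
  proof (rule summable_on_theta_bound[OF summable_theta_term3[of "norm q" "norm (u * v)" "norm v" "norm u"]])
    fix x :: "int \<times> int \<times> int"
    obtain i j k where x: "x = (i, j, k)" by (cases x)
    have "norm (nahm_term q u v (i, j, k)) \<le> (K * K * K) * (theta_term (norm q) (norm (u * v)) i *
            (theta_term (norm q) (norm v) j * theta_term (norm q) (norm u) k))"
    proof (cases "i < 0 \<or> j < 0 \<or> k < 0")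
      case True
      thus ?thesis using K q uv by (auto simp: nahm_term_def theta_term_nonneg)
    next
      case False
      have "norm (nahm_term q u v (i, j, k)) = norm q powi (i^2 + j^2 + k^2 + i * j + i * k) *
              (norm u powi (i + k) * norm v powi (i + j)) * (norm (rqp q i) * norm (rqp q j) * norm (rqp q k))"
        by (simp add: nahm_term_def norm_mult norm_power_int)
      also have "\<dots> \<le> norm q powi (i^2 + j^2 + k^2) * (norm u powi (i + k) * norm v powi (i + j)) * (K * K * K)"
        using False K q by (intro mult_mono[OF mult_right_mono[OF power_int_antimono]] mult_mono K(2)) auto
      also have "\<dots> = (K * K * K) * (theta_term (norm q) (norm (u * v)) i *
            (theta_term (norm q) (norm v) j * theta_term (norm q) (norm u) k))"
        using q uv by (simp add: theta_term_def power_int_add norm_mult power_int_mult_distrib)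
      finally show ?thesis .
    qed
    thus "norm (nahm_term q u v x) \<le> (K * K * K) * (case x of (x, y, z) \<Rightarrow>
            theta_term (norm q) (norm (u * v)) x * (theta_term (norm q) (norm v) y * theta_term (norm q) (norm u) z))"
      by (simp add: x)
  qed (use q uv in auto)
qed

text \<open>With a = i + k and b = i + j the quadratic form equals a^2 - ab + b^2 + (a-i)(b-i), and
  u, v carry only a and b; so the inner sum over i is q-Vandermonde.\<close>

lemma nahm_term_has_sum_imp_pair_term_has_sum:
  fixes q u v :: complex
  assumes q: "norm q < 1" "q \<noteq> 0" and uv: "u \<noteq> 0" "v \<noteq> 0"
    and S: "(nahm_term q u v has_sum S) UNIV"
  shows "(pair_term q u v has_sum S) UNIV"
proof -
  define h where "h = (\<lambda>(x, i). case x of (a, b) \<Rightarrow> nahm_term q u v (i, b - i, a - i))"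
  have "(h has_sum S) UNIV"
    by (rule has_sum_reindex_bij[OF S, where j = "\<lambda>((a, b), i). (i, b - i, a - i)"
               and i = "\<lambda>(i, j, k). ((i + k, i + j), i)"])
       (auto simp: h_def)
  thus ?thesis
  proof (rule has_sum_collapse)
    fix x :: "int \<times> int"
    obtain a b where x: "x = (a, b)" by (cases x)
    have "h (x, i) = q powi (a^2 - a * b + b^2) * u powi a * v powi b *
        (q powi ((a - i) * (b - i)) * rqp q i * rqp q (a - i) * rqp q (b - i))" for i
    proof -
      have "q powi (i^2 + (b - i)^2 + (a - i)^2 + i * (b - i) + i * (a - i)) =
              q powi (a^2 - a * b + b^2) * q powi ((a - i) * (b - i))"
        using q by (simp add: power_int_add[symmetric]) (simp add: power2_eq_square algebra_simps)
      thus ?thesis by (simp add: h_def x nahm_term_def)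
    qed
    thus "((\<lambda>i. h (x, i)) has_sum pair_term q u v x) UNIV"
      by (simp only: pair_term_def x prod.case) (intro has_sum_cmult_right has_sum_q_vandermonde q)
  qed
qed

text \<open>Inherited from the triple sum through the collapse, so the negative cross term -ab
  requires no estimate.\<close>

lemma summable_pair_term:
  fixes q u v :: complex
  assumes "norm q < 1" "q \<noteq> 0" "u \<noteq> 0" "v \<noteq> 0"
  shows "pair_term q u v summable_on UNIV"
  using nahm_term_has_sum_imp_pair_term_has_sum[OF assms] summable_nahm_term[OF assms]
  by (auto simp: summable_on_def)

definition pair_sum :: "complex \<Rightarrow> complex \<Rightarrow> complex \<Rightarrow> complex" where
  "pair_sum q u v = infsum (pair_term q u v) UNIV"

lemma has_sum_pair_sum:
  assumes "norm q < 1" "q \<noteq> 0" "u \<noteq> 0" "v \<noteq> 0"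
  shows "(pair_term q u v has_sum pair_sum q u v) UNIV"
  using summable_pair_term[OF assms] by (simp add: pair_sum_def)

lemma has_sum_nahm_term:
  fixes q u v :: complex
  assumes "norm q < 1" "q \<noteq> 0" "u \<noteq> 0" "v \<noteq> 0"
  shows "((\<lambda>(i, j, k). nahm_term q u v (int i, int j, int k)) has_sum pair_sum q u v) UNIV"
proof -
  obtain S where S: "(nahm_term q u v has_sum S) UNIV"
    using summable_nahm_term[OF assms] by (auto simp: summable_on_def)
  have "S = pair_sum q u v"
    using nahm_term_has_sum_imp_pair_term_has_sum[OF assms S] has_sum_pair_sum[OF assms] by (rule has_sum_unique)
  with S show ?thesis by (subst (asm) has_sum_int3_support) (auto simp: nahm_term_def)
qed

lemma pair_sum_commute:
  assumes "norm q < 1" "q \<noteq> 0" "u \<noteq> 0" "v \<noteq> 0"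
  shows "pair_sum q u v = pair_sum q v u"
proof -
  have "(pair_term q v u has_sum pair_sum q u v) UNIV"
    by (rule has_sum_reindex_bij[OF has_sum_pair_sum[OF assms], where i = prod.swap and j = prod.swap])
       (auto simp: pair_term_def algebra_simps)
  thus ?thesis using has_sum_pair_sum[of q v u] assms by (metis has_sum_unique)
qed

text \<open>Subtracting the terms for (uq, v) from those for (u, v) creates the factor 1 - q^a,
  which lowers a by one. The exponent then changes by 1 + 2(a-1) - b: the second part turns u into u
  q^2, the third v into v / q.\<close>

lemma pair_sum_rec:
  assumes q: "norm q < 1" "q \<noteq> 0" and uv: "u \<noteq> 0" "v \<noteq> 0"
  shows "pair_sum q u v = pair_sum q (u * q) v + u * q * pair_sum q (u * q^2) (v / q)"
proof -
  have term_rec: "pair_term q u v (a, b) - pair_term q (u * q) v (a, b) =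
      u * q * pair_term q (u * q^2) (v / q) (a - 1, b)" for a b
  proof -
    have "pair_term q u v (a, b) - pair_term q (u * q) v (a, b) =
        q powi (a^2 - a * b + b^2) * u powi a * v powi b * (((1 - q powi a) * rqp q a) * rqp q b)"
      by (simp add: pair_term_def power_int_mult_distrib algebra_simps)
    also have "\<dots> = q powi (a^2 - a * b + b^2) * u powi a * v powi b * (rqp q (a - 1) * rqp q b)"
      by (subst rqp_rec[OF q(1)]) simp
    also have "q powi (a^2 - a * b + b^2) =
        q powi ((a - 1)^2 - (a - 1) * b + b^2) * q powi 1 * q powi (2 * (a - 1)) * q powi (- b)"
      unfolding power_int_add[OF disjI1[OF q(2)], symmetric]
      by (rule arg_cong[of _ _ "\<lambda>n. q powi n"]) (simp add: power2_eq_square algebra_simps)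
    also have "q powi (2 * (a - 1)) = (q^2) powi (a - 1)"
      by (subst power_int_mult) simp
    also have "u powi a = u * u powi (a - 1)"
      using uv by (simp add: power_int_diff)
    finally show ?thesis
      using q uv by (simp add: pair_term_def power_int_mult_distrib power_int_divide_distrib power_int_minus
          field_simps)
  qed
  have "((\<lambda>x. pair_term q u v x - pair_term q (u * q) v x) has_sum
          pair_sum q u v - pair_sum q (u * q) v) UNIV"
    using has_sum_add[OF has_sum_pair_sum[of q u v] has_sum_uminusI[OF has_sum_pair_sum[of q "u * q" v]]] q uv
    by simp
  hence "((\<lambda>(a, b). u * q * pair_term q (u * q^2) (v / q) (a - 1, b)) has_sum
          pair_sum q u v - pair_sum q (u * q) v) UNIV"
    by (rule has_sum_reindex_bij[where i = id and j = id]) (auto simp: term_rec)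
  hence "((\<lambda>x. u * q * pair_term q (u * q^2) (v / q) x) has_sum pair_sum q u v - pair_sum q (u * q) v) UNIV"
    by (rule has_sum_reindex_bij[where j = "\<lambda>(a, b). (a + 1, b)" and i = "\<lambda>(a, b). (a - 1, b)"]) auto
  moreover have "((\<lambda>x. u * q * pair_term q (u * q^2) (v / q) x) has_sum
      u * q * pair_sum q (u * q^2) (v / q)) UNIV"
    using q uv by (intro has_sum_cmult_right has_sum_pair_sum) auto
  ultimately have "pair_sum q u v - pair_sum q (u * q) v = u * q * pair_sum q (u * q^2) (v / q)"
    by (rule has_sum_unique)
  thus ?thesis by (simp add: algebra_simps)
qed

text \<open>For uv = 1 the weight depends only on n = b - a, and the form becomes n^2 + a (a+n): a
  Durfee sum over a inside a Jacobi theta series over n.\<close>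

lemma pair_sum_theta:
  assumes q: "norm q < 1" "q \<noteq> 0" and z: "z \<noteq> 0"
  shows "pair_sum q (1 / z) z = qpoch_inf (- (q * z)) (q^2) * qpoch_inf (- (q / z)) (q^2) * qpoch_inf (q^2) (q^2)
           / qpoch_inf q q"
proof -
  have "(pair_term q (1 / z) z has_sum pair_sum q (1 / z) z) UNIV"
    using q z by (intro has_sum_pair_sum) auto
  hence "((\<lambda>(n, a). pair_term q (1 / z) z (a, a + n)) has_sum pair_sum q (1 / z) z) UNIV"
    by (rule has_sum_reindex_bij[where j = "\<lambda>(n, a). (a, a + n)" and i = "\<lambda>(a, b). (b - a, a)"]) auto
  hence "((\<lambda>n. q powi (n^2) * z powi n * (1 / qpoch_inf q q)) has_sum pair_sum q (1 / z) z) UNIV"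
  proof (rule has_sum_collapse)
    fix n
    have "pair_term q (1 / z) z (a, a + n) =
        q powi (n^2) * z powi n * (q powi (a * (a + n)) * rqp q a * rqp q (a + n))" for a
    proof -
      have "q powi (a^2 - a * (a + n) + (a + n)^2) = q powi (n^2) * q powi (a * (a + n))"
        using q by (simp add: power_int_add[symmetric]) (simp add: power2_eq_square algebra_simps)
      moreover have "(1 / z) powi a * z powi (a + n) = z powi n"
        using z by (simp add: power_int_add power_int_divide_distrib)
      ultimately show ?thesis by (simp add: pair_term_def mult_ac)
    qed
    thus "((\<lambda>a. case (n, a) of (n, a) \<Rightarrow> pair_term q (1 / z) z (a, a + n)) has_sum
            q powi (n^2) * z powi n * (1 / qpoch_inf q q)) UNIV"
      by (simp only: prod.case) (intro has_sum_cmult_right has_sum_durfee q)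
  qed
  from has_sum_unique[OF this has_sum_cmult_left[OF has_sum_jacobi_triple[OF q z]]]
  show ?thesis by simp
qed

subsection \<open>Bressoud sums\<close>

lemma summable_on_int_interval_support:
  fixes f :: "int \<Rightarrow> complex"
  assumes "\<And>x. x < l \<or> u < x \<Longrightarrow> f x = 0"
  shows "f summable_on UNIV"
proof (rule finite_nonzero_values_imp_summable_on)
  have "{x \<in> UNIV. f x \<noteq> 0} \<subseteq> {l..u}" using assms by force
  thus "finite {x \<in> UNIV. f x \<noteq> 0}" by (rule finite_subset) simp
qed

lemma has_sum_diff':
  fixes f g :: "'a \<Rightarrow> complex"
  assumes "(f has_sum S) A" "(g has_sum T) A"
  shows "((\<lambda>x. f x - g x) has_sum S - T) A"
  using has_sum_add[OF assms(1) has_sum_uminusI[OF assms(2)]] by simp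

text \<open>
  The inner sum M is the coefficient of t^n in (-t; q^2)_\<infinity> (-qt; q^2)_\<infinity> = (-t; q)_\<infinity>, and the outer one states
  (-t; q)_\<infinity> / (t^2; q^2)_\<infinity> = 1 / (t; q)_\<infinity>.
\<close>
lemma rqp_square_parity_convolution:
  fixes q :: complex
  assumes q: "norm q < 1" "q \<noteq> 0"
  shows "\<exists>M. (\<forall>n. ((\<lambda>x. q powi (x^2 - x + (n - x)^2) * (rqp (q^2) x * rqp (q^2) (n - x))) has_sum M n) UNIV)
    \<and> (\<forall>n. ((\<lambda>m. M (n - 2 * m) * rqp (q^2) m) has_sum rqp q n) UNIV)"
proof -
  define Q where "Q = q^2"
  have Q: "norm Q < 1" "Q \<noteq> 0" using q by (auto simp: Q_def norm_square_less_1)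
  have Q_powi: "Q powi n = q powi (2 * n)" for n by (simp add: Q_def power_int_mult)
  define f where "f n x = q powi (x^2 - x + (n - x)^2) * (rqp Q x * rqp Q (n - x))" for n x
  \<comment> \<open>Reflecting x to n - x shows that g sums to q^n times the sum of f. The
    difference f - g contains 1 - q^(2x), which lowers x and leaves g for n - 1; hence the
    recurrence \<open>M_rec\<close>.\<close>
  define g where "g n x = q powi (x^2 + x + (n - x)^2) * (rqp Q x * rqp Q (n - x))" for n x
  define M where "M n = infsum (f n) UNIV" for n
  have f: "(f n has_sum M n) UNIV" for n
    unfolding M_def by (intro has_sum_infsum summable_on_int_interval_support[of 0 n]) (auto simp: f_def)
  have g: "(g n has_sum q powi n * M n) UNIV" for n
  proof (rule has_sum_reindex_bij[OF has_sum_cmult_right[OF f], where j = "\<lambda>x. n - x" and i = "\<lambda>x. n - x"])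
    fix x
    have "q powi n * q powi ((n - x)^2 - (n - x) + x^2) = q powi (x^2 + x + (n - x)^2)"
      using q by (simp add: power_int_add[symmetric] algebra_simps)
    thus "g n x = q powi n * f n (n - x)" by (simp add: f_def g_def mult_ac)
  qed auto
  have M_rec: "(1 - q powi n) * M n = q powi (n - 1) * M (n - 1)" for n
  proof -
    have "((\<lambda>x. f n x - g n x) has_sum M n - q powi n * M n) UNIV" by (intro has_sum_diff' f g)
    hence "((\<lambda>x. f n (x + 1) - g n (x + 1)) has_sum M n - q powi n * M n) UNIV"
      by (rule has_sum_reindex_bij[where j = "\<lambda>x. x + 1" and i = "\<lambda>x. x - 1"]) auto
    also have "(\<lambda>x. f n (x + 1) - g n (x + 1)) = g (n - 1)"
    proof
      fix x
      have "q powi ((x + 1)^2 + (x + 1) + (n - (x + 1))^2) =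
              q powi ((x + 1)^2 - (x + 1) + (n - (x + 1))^2) * Q powi (x + 1)"
        unfolding Q_powi using q by (simp add: power_int_add[symmetric] algebra_simps)
      hence "f n (x + 1) - g n (x + 1) = q powi ((x + 1)^2 - (x + 1) + (n - (x + 1))^2) *
          (((1 - Q powi (x + 1)) * rqp Q (x + 1)) * rqp Q (n - (x + 1)))"
        by (simp add: f_def g_def algebra_simps)
      also have "\<dots> = g (n - 1) x"
        unfolding rqp_rec[OF Q(1)] g_def by (simp add: power2_eq_square algebra_simps)
      finally show "f n (x + 1) - g n (x + 1) = g (n - 1) x" .
    qed
    finally have "(g (n - 1) has_sum M n - q powi n * M n) UNIV" .
    from has_sum_unique[OF this g] show ?thesis by (simp add: algebra_simps)
  qed
  have M_neg: "M n = 0" if "n < 0" for n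
  proof -
    have "f n = (\<lambda>_. 0)" using that by (auto simp: f_def rqp_def fun_eq_iff)
    thus ?thesis by (simp add: M_def)
  qed
  have "f 0 x = 0" if "x \<noteq> 0" for x using that by (cases "x < 0") (auto simp: f_def)
  hence "(f 0 has_sum 1) UNIV"
    by (intro has_sum_finite_neutralI[of "{0}"]) (auto simp: f_def)
  hence M_0: "M 0 = 1" using f[of 0] by (metis has_sum_unique)

  define h where "h n m = M (n - 2 * m) * rqp Q m" for n m
  define C where "C n = infsum (h n) UNIV" for n
  have h_support: "h n m = 0" if "m < 0 \<or> n < m" for n m
    using that by (cases "m < 0") (auto simp: h_def M_neg)
  have h: "(h n has_sum C n) UNIV" for n
    unfolding C_def by (intro has_sum_infsum summable_on_int_interval_support[of 0 n] h_support)
  \<comment> \<open>Split 1 - q^n = (1 - q^(2m)) + q^(2m) (1 - q^(n-2m)): the first part lowers m,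
    the second lowers n by \<open>M_rec\<close>.\<close>
  have C_rec: "(1 - q powi n) * C n = C (n - 2) + q powi (n - 1) * C (n - 1)" for n
  proof -
    have "(1 - q powi n) * h n m = h (n - 2) (m - 1) + q powi (n - 1) * h (n - 1) m" for m
    proof -
      have "q powi n = Q powi m * q powi (n - 2 * m)"
        unfolding Q_powi using q by (simp add: power_int_add[symmetric])
      hence "(1 - q powi n) * h n m = M (n - 2 * m) * ((1 - Q powi m) * rqp Q m)
          + Q powi m * ((1 - q powi (n - 2 * m)) * M (n - 2 * m)) * rqp Q m"
        by (simp add: h_def algebra_simps)
      also have "\<dots> = M (n - 2 * m) * rqp Q (m - 1)
          + (Q powi m * q powi (n - 2 * m - 1)) * M (n - 2 * m - 1) * rqp Q m"
        unfolding rqp_rec[OF Q(1)] M_rec by (simp add: mult_ac)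
      also have "Q powi m * q powi (n - 2 * m - 1) = q powi (n - 1)"
        unfolding Q_powi using q by (simp add: power_int_add[symmetric])
      finally show ?thesis by (simp add: h_def algebra_simps)
    qed
    moreover have "((\<lambda>m. (1 - q powi n) * h n m) has_sum (1 - q powi n) * C n) UNIV"
      by (intro has_sum_cmult_right h)
    moreover have "((\<lambda>m. h (n - 2) (m - 1)) has_sum C (n - 2)) UNIV"
      by (rule has_sum_reindex_bij[OF h, where j = "\<lambda>m. m - 1" and i = "\<lambda>m. m + 1"]) auto
    hence "((\<lambda>m. h (n - 2) (m - 1) + q powi (n - 1) * h (n - 1) m) has_sum
             C (n - 2) + q powi (n - 1) * C (n - 1)) UNIV"
      by (intro has_sum_add has_sum_cmult_right h)
    ultimately show ?thesis by (simp add: has_sum_unique)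
  qed
  have C_neg: "C n = 0" if "n < 0" for n
  proof -
    have "h n = (\<lambda>_. 0)" using that by (auto simp: h_def rqp_def fun_eq_iff M_neg)
    thus ?thesis by (simp add: C_def)
  qed
  have "h 0 m = 0" if "m \<noteq> 0" for m using that by (cases "m < 0") (auto simp: h_def M_neg)
  hence "(h 0 has_sum 1) UNIV"
    by (intro has_sum_finite_neutralI[of "{0}"]) (auto simp: h_def M_0)
  hence C_0: "C 0 = 1" using h[of 0] by (metis has_sum_unique)
  \<comment> \<open>\<open>rqp q\<close> satisfies the same recurrence of order two. The second
    initial value is C(-1) = 0, used at k = 1.\<close>
  have "C (int k) = rqp q (int k)" for k
  proof (induction k rule: less_induct)
    case (less k)
    show ?case
    proof (cases k)
      case 0
      thus ?thesis by (simp add: C_0)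
    next
      case (Suc l)
      have l: "C (int k - 1) = rqp q (int k - 1)" using less[of l] Suc by simp
      have "C (int k - 2) = rqp q (int k - 2)"
        using less[of "l - 1"] Suc by (cases l) (auto simp: C_neg)
      also have "rqp q (int k - 2) = (1 - q powi (int k - 1)) * rqp q (int k - 1)"
        by (subst rqp_rec[OF q(1)]) simp
      finally have "(1 - q powi (int k)) * C (int k) = rqp q (int k - 1)"
        by (subst C_rec) (simp add: l algebra_simps)
      also have "\<dots> = (1 - q powi (int k)) * rqp q (int k)" by (rule rqp_rec[OF q(1), symmetric])
      finally show ?thesis
        using power_Suc_neq_1[OF q(1), of l] Suc by (simp only: power_int_of_nat) auto
    qed
  qed
  hence "C n = rqp q n" for n by (cases n rule: int_cases) (auto simp: C_neg)
  with f h show ?thesis by (intro exI[of _ M]) (auto simp: f_def[abs_def] h_def[abs_def] Q_def)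
qed

section \<open>Gauss's alternating sum, the fourfold sums and Bressoud's double sums\<close>

lemma has_sum_antisymmetric:
  fixes f :: "int \<Rightarrow> complex"
  assumes "f summable_on UNIV" "\<And>r. f (c - r) = - f r"
  shows "(f has_sum 0) UNIV"
proof -
  obtain S where S: "(f has_sum S) UNIV" using assms(1) by (auto simp: summable_on_def)
  have "((\<lambda>r. - f r) has_sum S) UNIV"
    by (rule has_sum_reindex_bij[OF S, where j = "\<lambda>r. c - r" and i = "\<lambda>r. c - r"]) (auto simp: assms)
  hence "S = - S" using has_sum_uminusI[OF S] by (rule has_sum_unique)
  thus ?thesis using S by simp
qed

text \<open>The terms for e = 1 differ from those for e = 0 by a multiple of \<open>d\<close>, and
  the terms for e = 1 at s - 1 differ from 1 - q^(2s) times those for e = 0 at s by a multiple of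
  \<open>d'\<close>. Both corrections are antisymmetric and sum to 0, so the two cases share one sum
  P with (1 - q^(2s)) P(s) = P(s-1).\<close>

lemma has_sum_gauss:
  fixes q :: complex
  assumes q: "norm q < 1" "q \<noteq> 0" and e: "e = 0 \<or> e = 1"
  shows "((\<lambda>r. (if even r then 1 else -1) * q powi (r^2) * rqp q (s - r) * rqp q (s + r + e))
           has_sum rqp (q^2) s) UNIV"
proof -
  define \<epsilon> :: "int \<Rightarrow> complex" where "\<epsilon> r = (if even r then 1 else -1)" for r
  define p where "p e s r = \<epsilon> r * q powi (r^2) * rqp q (s - r) * rqp q (s + r + e)" for e s r
  define d where "d s r = \<epsilon> r * q powi (r^2 + r) * rqp q (s - r) * rqp q (s + r + 1)" for s r
  define d' where "d' s r = \<epsilon> r * q powi (r^2 - r) * rqp q (s - r) * rqp q (s + r - 1)" for s r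
  define P where "P s = infsum (p 0 s) UNIV" for s
  note q2 = norm_square_less_1[OF q(1)]
  have p0: "(p 0 s has_sum P s) UNIV" for s
    unfolding P_def by (intro has_sum_infsum summable_on_int_interval_support[of "-s" s]) (auto simp: p_def)
  \<comment> \<open>r^2 + r is invariant under r \<rightarrow> -1 - r and r^2 - r under r
    \<rightarrow> 1 - r; each reflection exchanges the two \<open>rqp\<close> factors and flips the
    sign.\<close>
  have "\<epsilon> (- 1 - r) = - \<epsilon> r" "\<epsilon> (1 - r) = - \<epsilon> r" for r by (auto simp: \<epsilon>_def)
  hence d_anti: "d s (- 1 - r) = - d s r" and d'_anti: "d' s (1 - r) = - d' s r" for s r
    by (simp_all add: d_def d'_def power2_eq_square algebra_simps)
  have d: "(d s has_sum 0) UNIV" for s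
    by (rule has_sum_antisymmetric[where c = "-1" and f = "d s", OF _ d_anti], rule summable_on_int_interval_support[of "-s-1" s])
       (auto simp: d_def)
  have d': "(d' s has_sum 0) UNIV" for s
    by (rule has_sum_antisymmetric[where c = 1 and f = "d' s", OF _ d'_anti], rule summable_on_int_interval_support[of "1-s" s])
       (auto simp: d'_def)
  have p1: "(p 1 s has_sum P s) UNIV" for s
  proof -
    have "p 1 s r = p 0 s r + q powi (s + 1) * d s r" for r
    proof -
      have "p 0 s r = \<epsilon> r * q powi (r^2) * rqp q (s - r) * ((1 - q powi (s + r + 1)) * rqp q (s + r + 1))"
        by (subst rqp_rec[OF q(1)]) (simp add: p_def)
      also have "\<dots> = p 1 s r - \<epsilon> r * (q powi (r^2) * q powi (s + r + 1)) * rqp q (s - r) * rqp q (s + r + 1)"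
        by (simp add: p_def algebra_simps)
      also have "q powi (r^2) * q powi (s + r + 1) = q powi (s + 1) * q powi (r^2 + r)"
        using q by (simp add: power_int_add[symmetric] algebra_simps)
      finally show ?thesis by (simp add: d_def mult_ac)
    qed
    hence "p 1 s = (\<lambda>r. p 0 s r + q powi (s + 1) * d s r)" by blast
    thus ?thesis using has_sum_add[OF p0 has_sum_cmult_right[OF d, of "q powi (s + 1)"], of s s] by simp
  qed
  have P_rec: "(1 - (q^2) powi s) * P s = P (s - 1)" for s
  proof -
    \<comment> \<open>All three terms are multiples of \<open>rqp q (s - r) * rqp q (s + r)\<close>,
      which leaves an identity between powers of q.\<close>
    have "p 1 (s - 1) r = (1 - (q^2) powi s) * p 0 s r - q powi s * d' s r" for r
    proof -
      have "p 1 (s - 1) r = \<epsilon> r * q powi (r^2) * ((1 - q powi (s - r)) * rqp q (s - r)) * rqp q (s + r)"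
        by (subst rqp_rec[OF q(1)]) (simp add: p_def algebra_simps)
      moreover have "d' s r = \<epsilon> r * q powi (r^2 - r) * rqp q (s - r) * ((1 - q powi (s + r)) * rqp q (s + r))"
        by (subst rqp_rec[OF q(1)]) (simp add: d'_def algebra_simps)
      moreover have "q powi (r^2) * (1 - q powi (s - r)) =
          (1 - (q^2) powi s) * q powi (r^2) - q powi s * q powi (r^2 - r) * (1 - q powi (s + r))"
      proof -
        have "q powi (r^2) * q powi (s - r) = q powi s * q powi (r^2 - r)"
          using q by (simp add: power_int_add[symmetric] algebra_simps)
        moreover have "q powi s * (q powi (r^2 - r) * q powi (s + r)) = (q^2) powi s * q powi (r^2)"
        proof -
          have "(q^2) powi s = q powi (2 * s)" by (simp add: power_int_mult)
          thus ?thesis using q by (simp add: power_int_add[symmetric] algebra_simps)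
        qed
        ultimately show ?thesis by (simp add: algebra_simps)
      qed
      ultimately have A: "p 1 (s - 1) r = \<epsilon> r * ((1 - (q^2) powi s) * q powi (r^2)
          - q powi s * q powi (r^2 - r) * (1 - q powi (s + r))) * rqp q (s - r) * rqp q (s + r)"
        and B: "d' s r = \<epsilon> r * q powi (r^2 - r) * rqp q (s - r) * ((1 - q powi (s + r)) * rqp q (s + r))"
        by (simp_all add: mult_ac)
      show ?thesis unfolding A B by (simp add: p_def algebra_simps)
    qed
    hence "p 1 (s - 1) = (\<lambda>r. (1 - (q^2) powi s) * p 0 s r - q powi s * d' s r)" by blast
    hence "(p 1 (s - 1) has_sum (1 - (q^2) powi s) * P s) UNIV"
      using has_sum_diff'[OF has_sum_cmult_right[OF p0, of "1 - (q^2) powi s"] has_sum_cmult_right[OF d', of "q powi s"], of s s]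
      by simp
    thus ?thesis using p1[of "s - 1"] by (rule has_sum_unique)
  qed
  have P_neg: "P s = 0" if "s < 0" for s
  proof -
    have "p 0 s = (\<lambda>_. 0)" using that by (auto simp: p_def rqp_def fun_eq_iff)
    thus ?thesis by (simp add: P_def)
  qed
  have "p 0 0 r = 0" if "r \<noteq> 0" for r using that by (cases "r < 0") (auto simp: p_def)
  hence "(p 0 0 has_sum 1) UNIV"
    by (intro has_sum_finite_neutralI[of "{0}"]) (auto simp: p_def \<epsilon>_def)
  hence P_0: "P 0 = 1" using p0[of 0] by (metis has_sum_unique)
  have "P (int n) = rqp (q^2) (int n)" for n
  proof (induction n)
    case (Suc n)
    have "(1 - (q^2) powi (int (Suc n))) * P (int (Suc n)) = (1 - (q^2) powi (int (Suc n))) * rqp (q^2) (int (Suc n))"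
      unfolding P_rec rqp_rec[OF q2] using Suc by simp
    thus ?case using power_Suc_neq_1[OF q2, of n] by (simp only: power_int_of_nat) auto
  qed (simp add: P_0)
  from this[of "nat s"] have "P s = rqp (q^2) s" by (cases "s < 0") (auto simp: P_neg)
  moreover have "(p e s has_sum P s) UNIV" using e p0 p1 by auto
  ultimately show ?thesis by (simp add: p_def[abs_def] \<epsilon>_def)
qed

text \<open>Here m is the q-Vandermonde index and x + y + b + 2 m stands for i + j + k. The case e =
  0 belongs to the fourth identity, e = 1 to the third.\<close>

definition quad_term :: "complex \<Rightarrow> int \<Rightarrow> int \<times> int \<times> int \<times> int \<Rightarrow> complex" where
  "quad_term q e = (\<lambda>(x, y, b, m).
     q powi ((x + y + b + 2 * m)^2 + e * (x + y + b + 2 * m) + x^2 - x + y^2 + b^2 + e * b)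
       * (rqp (q^2) x * rqp (q^2) y * rqp (q^2) b * rqp (q^2) m))"

definition bressoud_term :: "complex \<Rightarrow> int \<Rightarrow> int \<times> int \<Rightarrow> complex" where
  "bressoud_term q e = (\<lambda>(s, R). q powi ((s + R)^2 + e * (s + R) + s^2 + e * s) * (rqp (q^2) s * rqp q R))"

text \<open>The square of x + y + b + 2m is used only through its lower bound m^2, the one square
  absent from the rest of the exponent. The linear term -x becomes the weight 1 / |q|.\<close>

lemma summable_quad_term:
  fixes q :: complex
  assumes q: "norm q < 1" "q \<noteq> 0" and e: "e \<ge> 0"
  shows "quad_term q e summable_on UNIV"
proof -
  obtain K where K: "K > 0" "\<And>n. norm (rqp (q^2) n) \<le> K"
    using rqp_bounded[OF norm_square_less_1[OF q(1)]] by metis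
  show ?thesis
  proof (rule summable_on_theta_bound[OF summable_theta_term4[of "norm q" "1 / norm q" 1 1 1]])
    fix t :: "int \<times> int \<times> int \<times> int"
    obtain x y b m where t: "t = (x, y, b, m)" by (cases t)
    have "norm (quad_term q e (x, y, b, m)) \<le> (K * K * K * K) * (theta_term (norm q) (1 / norm q) x *
            (theta_term (norm q) 1 y * (theta_term (norm q) 1 b * theta_term (norm q) 1 m)))"
    proof (cases "x < 0 \<or> y < 0 \<or> b < 0 \<or> m < 0")
      case True
      thus ?thesis using K q by (auto simp: quad_term_def theta_term_nonneg)
    next
      case False
      have "m^2 \<le> (x + y + b + 2 * m)^2" using False by (intro power_mono) auto
      moreover have "0 \<le> e * (x + y + b + 2 * m)" "0 \<le> e * b" using False e by auto
      ultimately have le: "x^2 + (- x) + y^2 + b^2 + m^2 \<le>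
          (x + y + b + 2 * m)^2 + e * (x + y + b + 2 * m) + x^2 - x + y^2 + b^2 + e * b" by linarith
      have "norm (quad_term q e (x, y, b, m)) =
          norm q powi ((x + y + b + 2 * m)^2 + e * (x + y + b + 2 * m) + x^2 - x + y^2 + b^2 + e * b) *
            (norm (rqp (q^2) x) * norm (rqp (q^2) y) * norm (rqp (q^2) b) * norm (rqp (q^2) m))"
        by (simp add: quad_term_def norm_mult norm_power_int)
      also have "\<dots> \<le> norm q powi (x^2 + (- x) + y^2 + b^2 + m^2) * (K * K * K * K)"
        using K q by (intro mult_mono[OF power_int_antimono] mult_mono K(2) le) auto
      also have "\<dots> = (K * K * K * K) * (theta_term (norm q) (1 / norm q) x *
            (theta_term (norm q) 1 y * (theta_term (norm q) 1 b * theta_term (norm q) 1 m)))"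
        using q by (simp add: theta_term_def power_int_add power_int_minus power_int_inverse divide_inverse
            mult_ac del: add_uminus_conv_diff)
      finally show ?thesis .
    qed
    thus "norm (quad_term q e t) \<le> (K * K * K * K) * (case t of (w, x, y, z) \<Rightarrow>
            theta_term (norm q) (1 / norm q) w * (theta_term (norm q) 1 x *
              (theta_term (norm q) 1 y * theta_term (norm q) 1 z)))"
      by (simp add: t)
  qed (use q in auto)
qed

text \<open>Regroup with s = b and R = x + y + 2m, so that x + y + b + 2m = s + R. Summing over x
  gives M(R - 2m), and summing over m turns the base q^2 factors into 1 / (q; q)_R.\<close>

lemma quad_term_has_sum_imp_bressoud_term_has_sum:
  fixes q :: complex
  assumes q: "norm q < 1" "q \<noteq> 0" and S: "(quad_term q e has_sum S) UNIV"
  shows "(bressoud_term q e has_sum S) UNIV"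
proof -
  obtain M where M: "\<And>n. ((\<lambda>x. q powi (x^2 - x + (n - x)^2) * (rqp (q^2) x * rqp (q^2) (n - x))) has_sum M n) UNIV"
    "\<And>n. ((\<lambda>m. M (n - 2 * m) * rqp (q^2) m) has_sum rqp q n) UNIV"
    using rqp_square_parity_convolution[OF q] by blast
  define w where "w s R = q powi ((s + R)^2 + e * (s + R) + s^2 + e * s) * rqp (q^2) s" for s R
  define h where "h = (\<lambda>(((s, R), m), x). quad_term q e (x, R - 2 * m - x, s, m))"
  have h: "h (((s, R), m), x) = w s R * rqp (q^2) m *
      (q powi (x^2 - x + (R - 2 * m - x)^2) * (rqp (q^2) x * rqp (q^2) (R - 2 * m - x)))" for s R m x
  proof -
    have N: "x + (R - 2 * m - x) + s + 2 * m = s + R" by simp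
    have "q powi ((s + R)^2 + e * (s + R) + x^2 - x + (R - 2 * m - x)^2 + s^2 + e * s) =
        q powi ((s + R)^2 + e * (s + R) + s^2 + e * s) * q powi (x^2 - x + (R - 2 * m - x)^2)"
      using q by (subst power_int_add[symmetric]) (auto intro!: arg_cong[of _ _ "\<lambda>n. q powi n"])
    thus ?thesis unfolding h_def quad_term_def w_def prod.case N by simp
  qed
  have "(h has_sum S) UNIV"
    by (rule has_sum_reindex_bij[OF S, where j = "\<lambda>(((s, R), m), x). (x, R - 2 * m - x, s, m)"
          and i = "\<lambda>(x, y, s, m). (((s, x + y + 2 * m), m), x)"])
       (auto simp: h_def)
  define g where "g = (\<lambda>((s, R), m). w s R * rqp (q^2) m * M (R - 2 * m))"
  from \<open>(h has_sum S) UNIV\<close> have "(g has_sum S) UNIV"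
  proof (rule has_sum_collapse)
    fix t :: "(int \<times> int) \<times> int"
    obtain s R m where t: "t = ((s, R), m)" by (metis surj_pair)
    show "((\<lambda>x. h (t, x)) has_sum g t) UNIV"
      unfolding t h g_def prod.case by (intro has_sum_cmult_right M)
  qed
  thus ?thesis
  proof (rule has_sum_collapse)
    fix t :: "int \<times> int"
    obtain s R where t: "t = (s, R)" by (cases t)
    have "((\<lambda>m. w s R * (M (R - 2 * m) * rqp (q^2) m)) has_sum w s R * rqp q R) UNIV"
      by (intro has_sum_cmult_right M)
    thus "((\<lambda>m. g (t, m)) has_sum bressoud_term q e t) UNIV"
      by (simp add: t g_def bressoud_term_def w_def mult_ac)
  qed
qed

text \<open>Gauss's sum expands 1 / (q^2; q^2)_s over r. For fixed N = s + R and r the sum over s is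
  q-Vandermonde with upper arguments N - r and N + r + e; the sum over N is then a Durfee sum, and
  the alternating theta series over r is a Jacobi product.\<close>

lemma has_sum_bressoud_term:
  fixes q :: complex
  assumes q: "norm q < 1" "q \<noteq> 0" and e: "e = 0 \<or> e = 1"
  shows "(bressoud_term q e has_sum
           qpoch_inf (q^3 * q powi (2 * e)) (q^6) * qpoch_inf (q^3 / q powi (2 * e)) (q^6) * qpoch_inf (q^6) (q^6)
             / qpoch_inf q q) UNIV"
proof -
  obtain K where K: "K > 0" "\<And>n. norm (rqp q n) \<le> K" using rqp_bounded[OF q(1)] by metis
  define \<epsilon> :: "int \<Rightarrow> complex" where "\<epsilon> r = (if even r then 1 else -1)" for r
  define T where "T = (\<lambda>((s, R), r). q powi ((s + R)^2 + e * (s + R) + s^2 + e * s) * rqp q R *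
     (\<epsilon> r * q powi (r^2) * rqp q (s - r) * rqp q (s + r + e)))"
  have "(\<lambda>(s, R, r). T ((s, R), r)) summable_on UNIV"
  proof (rule summable_on_theta_bound[OF summable_theta_term3[of "norm q" 1 1 1]])
    fix x :: "int \<times> int \<times> int"
    obtain s R r where x: "x = (s, R, r)" by (cases x)
    have "norm (T ((s, R), r)) \<le> (K * K * K) * (theta_term (norm q) 1 s *
            (theta_term (norm q) 1 R * theta_term (norm q) 1 r))"
    proof (cases "R < 0 \<or> s - r < 0 \<or> s + r + e < 0")
      case True
      thus ?thesis using K q by (auto simp: T_def theta_term_nonneg)
    next
      case False
      \<comment> \<open>Adding the two constraints on s gives 2s + e \<ge> 0, hence s \<ge> 0 as e
        \<le> 1. The index r may have either sign; its decay comes from the factor q^(r^2).\<close>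
      hence sR: "s \<ge> 0" "R \<ge> 0" using e by auto
      have "R^2 \<le> (s + R)^2" using sR by (intro power_mono) auto
      moreover have "0 \<le> e * (s + R)" "0 \<le> e * s" using sR e by auto
      ultimately have le: "s^2 + R^2 \<le> (s + R)^2 + e * (s + R) + s^2 + e * s" by linarith
      have "norm (T ((s, R), r)) = norm q powi ((s + R)^2 + e * (s + R) + s^2 + e * s) * norm q powi (r^2) *
              (norm (rqp q R) * norm (rqp q (s - r)) * norm (rqp q (s + r + e)))"
        by (simp add: T_def \<epsilon>_def norm_mult norm_power_int)
      also have "\<dots> \<le> norm q powi (s^2 + R^2) * norm q powi (r^2) * (K * K * K)"
        using K q by (intro mult_mono[OF mult_right_mono[OF power_int_antimono]] mult_mono K(2) le) auto
      also have "\<dots> = (K * K * K) * (theta_term (norm q) 1 s *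
            (theta_term (norm q) 1 R * theta_term (norm q) 1 r))"
        using q by (simp add: theta_term_def power_int_add)
      finally show ?thesis .
    qed
    thus "norm (case x of (s, R, r) \<Rightarrow> T ((s, R), r)) \<le> (K * K * K) * (case x of (x, y, z) \<Rightarrow>
            theta_term (norm q) 1 x * (theta_term (norm q) 1 y * theta_term (norm q) 1 z))"
      by (simp add: x)
  qed (use q in auto)
  then obtain S where S': "((\<lambda>(s, R, r). T ((s, R), r)) has_sum S) UNIV" by (auto simp: summable_on_def)
  have S: "(T has_sum S) UNIV"
    by (rule has_sum_reindex_bij[OF S', where j = "\<lambda>((s, R), r). (s, R, r)" and i = "\<lambda>(s, R, r). ((s, R), r)"]) auto
  \<comment> \<open>Summing over r first undoes Gauss's expansion; the reindexing below by N
    evaluates the same total S.\<close>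
  have B: "(bressoud_term q e has_sum S) UNIV"
  proof (rule has_sum_collapse[OF S])
    fix x :: "int \<times> int"
    obtain s R where x: "x = (s, R)" by (cases x)
    have "((\<lambda>r. T ((s, R), r)) has_sum
        q powi ((s + R)^2 + e * (s + R) + s^2 + e * s) * rqp q R * rqp (q^2) s) UNIV"
      unfolding T_def \<epsilon>_def prod.case by (intro has_sum_cmult_right has_sum_gauss q e)
    thus "((\<lambda>r. T (x, r)) has_sum bressoud_term q e x) UNIV"
      by (simp add: x bressoud_term_def mult_ac)
  qed
  define h where "h = (\<lambda>((r, N), s). T ((s, N - s), r))"
  have "(h has_sum S) UNIV"
    by (rule has_sum_reindex_bij[OF S, where j = "\<lambda>((r, N), s). ((s, N - s), r)"
          and i = "\<lambda>((s, R), r). ((r, s + R), s)"])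
       (auto simp: h_def)
  hence "((\<lambda>(r, N). \<epsilon> r * q powi (N^2 + e * N + 2 * r^2 + e * r) * (rqp q (N - r) * rqp q (N + r + e))) has_sum S) UNIV"
  proof (rule has_sum_collapse)
    fix x :: "int \<times> int"
    obtain r N where x: "x = (r, N)" by (cases x)
    have "((\<lambda>s. q powi ((s - r) * (s + r + e)) * rqp q (N - s) * rqp q (s - r) * rqp q (s + r + e)) has_sum
             rqp q (N - r) * rqp q (N + r + e)) UNIV"
      by (rule has_sum_reindex_bij[OF has_sum_q_vandermonde[OF q, of "N - r" "N + r + e"],
            where i = "\<lambda>s. N - s" and j = "\<lambda>s. N - s"]) (auto simp: algebra_simps)
    hence "((\<lambda>s. \<epsilon> r * q powi (N^2 + e * N + 2 * r^2 + e * r) *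
          (q powi ((s - r) * (s + r + e)) * rqp q (N - s) * rqp q (s - r) * rqp q (s + r + e))) has_sum
             \<epsilon> r * q powi (N^2 + e * N + 2 * r^2 + e * r) * (rqp q (N - r) * rqp q (N + r + e))) UNIV"
      by (rule has_sum_cmult_right)
    moreover have "h (x, s) = \<epsilon> r * q powi (N^2 + e * N + 2 * r^2 + e * r) *
          (q powi ((s - r) * (s + r + e)) * rqp q (N - s) * rqp q (s - r) * rqp q (s + r + e))" for s
    proof -
      have "q powi ((s + (N - s))^2 + e * (s + (N - s)) + s^2 + e * s) * q powi (r^2) =
        q powi (N^2 + e * N + 2 * r^2 + e * r) * q powi ((s - r) * (s + r + e))"
        unfolding power_int_add[OF disjI1[OF q(2)], symmetric]
        by (rule arg_cong[of _ _ "\<lambda>n. q powi n"]) (simp add: power2_eq_square algebra_simps)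
      thus ?thesis by (simp add: h_def x T_def mult_ac)
    qed
    ultimately show "((\<lambda>s. h (x, s)) has_sum (case x of (r, N) \<Rightarrow>
        \<epsilon> r * q powi (N^2 + e * N + 2 * r^2 + e * r) * (rqp q (N - r) * rqp q (N + r + e)))) UNIV"
      by (simp add: x)
  qed
  hence "((\<lambda>r. \<epsilon> r * q powi (3 * r^2 + 2 * e * r) * (1 / qpoch_inf q q)) has_sum S) UNIV"
  proof (rule has_sum_collapse)
    fix r
    have "((\<lambda>N. q powi ((N - r) * (N + r + e)) * rqp q (N - r) * rqp q (N + r + e)) has_sum 1 / qpoch_inf q q) UNIV"
      by (rule has_sum_reindex_bij[OF has_sum_durfee[OF q, of "2 * r + e"],
            where i = "\<lambda>m. m + r" and j = "\<lambda>N. N - r"]) (auto simp: algebra_simps)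
    hence "((\<lambda>N. \<epsilon> r * q powi (3 * r^2 + 2 * e * r) *
             (q powi ((N - r) * (N + r + e)) * rqp q (N - r) * rqp q (N + r + e))) has_sum
           \<epsilon> r * q powi (3 * r^2 + 2 * e * r) * (1 / qpoch_inf q q)) UNIV"
      by (rule has_sum_cmult_right)
    moreover have "q powi (N^2 + e * N + 2 * r^2 + e * r) =
        q powi (3 * r^2 + 2 * e * r) * q powi ((N - r) * (N + r + e))" for N
      unfolding power_int_add[OF disjI1[OF q(2)], symmetric]
      by (rule arg_cong[of _ _ "\<lambda>n. q powi n"]) (simp add: power2_eq_square algebra_simps)
    ultimately show "((\<lambda>N. case (r, N) of (r, N) \<Rightarrow> \<epsilon> r * q powi (N^2 + e * N + 2 * r^2 + e * r) *
        (rqp q (N - r) * rqp q (N + r + e))) has_sum \<epsilon> r * q powi (3 * r^2 + 2 * e * r) * (1 / qpoch_inf q q)) UNIV"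
      by (simp add: mult_ac)
  qed
  moreover have "((\<lambda>r. \<epsilon> r * q powi (3 * r^2 + 2 * e * r) * (1 / qpoch_inf q q)) has_sum
     qpoch_inf (q^3 * q powi (2 * e)) (q^6) * qpoch_inf (q^3 / q powi (2 * e)) (q^6) * qpoch_inf (q^6) (q^6)
       * (1 / qpoch_inf q q)) UNIV"
  proof (rule has_sum_cmult_left)
    have q3: "norm (q^3) < 1" using q by (simp add: norm_power power_less_one_iff)
    \<comment> \<open>Jacobi's identity in base q^3 with z = -q^(2e); the sign of z absorbs
      (-1)^r.\<close>
    have "(q^3) powi (r^2) * (- (q powi (2 * e))) powi r = \<epsilon> r * q powi (3 * r^2 + 2 * e * r)" for r
    proof -
      have "(q^3) powi (r^2) = q powi (3 * r^2)" by (simp add: power_int_mult)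
      moreover have "(q powi (2 * e)) powi r = q powi (2 * e * r)" by (simp add: power_int_mult)
      ultimately show ?thesis using q
        by (simp add: \<epsilon>_def power_int_minus_left power_int_add)
    qed
    thus "((\<lambda>r. \<epsilon> r * q powi (3 * r^2 + 2 * e * r)) has_sum
      qpoch_inf (q^3 * q powi (2 * e)) (q^6) * qpoch_inf (q^3 / q powi (2 * e)) (q^6) * qpoch_inf (q^6) (q^6)) UNIV"
      using has_sum_jacobi_triple[OF q3, of "- (q powi (2 * e))"] q by simp
  qed
  ultimately have "S = qpoch_inf (q^3 * q powi (2 * e)) (q^6) * qpoch_inf (q^3 / q powi (2 * e)) (q^6)
      * qpoch_inf (q^6) (q^6) * (1 / qpoch_inf q q)"
    by (rule has_sum_unique)
  thus ?thesis using B by simp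
qed

lemma has_sum_quad_term:
  fixes q :: complex
  assumes q: "norm q < 1" "q \<noteq> 0" and e: "e = 0 \<or> e = 1"
  shows "(quad_term q e has_sum
           qpoch_inf (q^3 * q powi (2 * e)) (q^6) * qpoch_inf (q^3 / q powi (2 * e)) (q^6) * qpoch_inf (q^6) (q^6)
             / qpoch_inf q q) UNIV"
proof -
  obtain S where S: "(quad_term q e has_sum S) UNIV"
    using summable_quad_term[OF q, of e] e by (auto simp: summable_on_def)
  from has_sum_unique[OF quad_term_has_sum_imp_bressoud_term_has_sum[OF q S] has_sum_bressoud_term[OF q e]] S
  show ?thesis by simp
qed

subsection \<open>The five identities\<close>

text \<open>The fourfold sum is indexed by (x, y, b, m) with (i, j, k) = (x, y + m, b + m) here, but
  (i, j, k) = (y, x + m, b + m) in the next lemma.\<close>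
lemma has_sum_nahm_theta_zero:
  fixes q :: complex
  assumes q: "norm q < 1" "q \<noteq> 0"
  shows "((\<lambda>(i, j, k). q powi (2*int i^2 + 2*int j^2 + 2*int k^2 + 2*int i*int j + 2*int i*int k - int i)
          / (qpoch (q^2) (q^2) i * qpoch (q^2) (q^2) j * qpoch (q^2) (q^2) k))
       has_sum (qpoch_inf (q^3) (q^3) ^ 2 / (qpoch_inf q q * qpoch_inf (q^6) (q^6)))) UNIV"
proof -
  note q2 = norm_square_less_1[OF q(1)]
  define S where "S = qpoch_inf (q^3) (q^6) ^ 2 * qpoch_inf (q^6) (q^6) / qpoch_inf q q"
  define F :: "int \<times> int \<times> int \<Rightarrow> complex" where
    "F = (\<lambda>(i, j, k). q powi (2*i^2 + 2*j^2 + 2*k^2 + 2*i*j + 2*i*k - i)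
          * rqp (q^2) i * (rqp (q^2) j * rqp (q^2) k))"
  have S: "(quad_term q 0 has_sum S) UNIV"
    using has_sum_quad_term[OF q, of 0] by (simp add: S_def power2_eq_square)
  \<comment> \<open>Summing over m at fixed (i, j, k) undoes the q-Vandermonde expansion of
    \<open>rqp (q^2) j * rqp (q^2) k\<close>, so the triple sum inherits the known total S.\<close>
  define h where "h = (\<lambda>(t, m). case t of (i, j, k) \<Rightarrow> quad_term q 0 (i, j - m, k - m, m))"
  have "(h has_sum S) UNIV"
    by (rule has_sum_reindex_bij[OF S, where j = "\<lambda>((i, j, k), m). (i, j - m, k - m, m)"
          and i = "\<lambda>(x, y, b, m). ((x, y + m, b + m), m)"])
       (auto simp: h_def)
  hence "(F has_sum S) UNIV"
  proof (rule has_sum_collapse)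
    fix t :: "int \<times> int \<times> int"
    obtain i j k where t: "t = (i, j, k)" by (cases t)
    have "h (t, m) = q powi (2*i^2 + 2*j^2 + 2*k^2 + 2*i*j + 2*i*k - i) * rqp (q^2) i *
        ((q^2) powi ((j - m) * (k - m)) * rqp (q^2) m * rqp (q^2) (j - m) * rqp (q^2) (k - m))" for m
    proof -
      have "(q^2) powi ((j - m) * (k - m)) = q powi (2 * ((j - m) * (k - m)))" by (simp add: power_int_mult)
      moreover have "q powi (2*i^2 + 2*j^2 + 2*k^2 + 2*i*j + 2*i*k - i) * q powi (2 * ((j - m) * (k - m))) =
          q powi ((i + (j - m) + (k - m) + 2 * m)^2 + 0 * (i + (j - m) + (k - m) + 2 * m) + i^2 - i + (j - m)^2
            + (k - m)^2 + 0 * (k - m))"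
        unfolding power_int_add[OF disjI1[OF q(2)], symmetric]
        by (rule arg_cong[of _ _ "\<lambda>n. q powi n"]) (simp add: power2_eq_square algebra_simps)
      ultimately show ?thesis by (simp add: h_def t quad_term_def mult_ac)
    qed
    thus "((\<lambda>m. h (t, m)) has_sum F t) UNIV"
      unfolding F_def t prod.case using q by (simp only:) (intro has_sum_cmult_right has_sum_q_vandermonde q2; simp)
  qed
  hence "((\<lambda>(i, j, k). F (int i, int j, int k)) has_sum S) UNIV"
    by (subst (asm) has_sum_int3_support) (auto simp: F_def)
  moreover have "S = qpoch_inf (q^3) (q^3) ^ 2 / (qpoch_inf q q * qpoch_inf (q^6) (q^6))"
  proof -
    have "norm (q^3) < 1" "norm (q^6) < 1" using q by (simp_all add: norm_power power_less_one_iff)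
    hence "qpoch_inf (q^3) (q^3) = qpoch_inf (q^3) (q^6) * qpoch_inf (q^6) (q^6)" "qpoch_inf (q^6) (q^6) \<noteq> 0"
      using qpoch_inf_split_parity[of "q^3" "q^3"] qpoch_inf_nonzero by (auto simp: power_add[symmetric])
    thus ?thesis by (simp add: S_def power2_eq_square)
  qed
  ultimately show ?thesis by (simp add: F_def rqp_of_nat case_prod_unfold mult.assoc)
qed

text \<open>The linear form i + 2k equals (i+j+k) - j + k, so the index x with the extra term -x is
  j - m; in the fourth identity, with linear form -i, it is i itself.\<close>

lemma has_sum_nahm_theta_one:
  fixes q :: complex
  assumes q: "norm q < 1" "q \<noteq> 0"
  shows "((\<lambda>(i, j, k). q ^ (2*i^2 + 2*j^2 + 2*k^2 + 2*i*j + 2*i*k + i + 2*k)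
          / (qpoch (q^2) (q^2) i * qpoch (q^2) (q^2) j * qpoch (q^2) (q^2) k))
       has_sum (qpoch_inf q (q^6) * qpoch_inf (q^5) (q^6) * qpoch_inf (q^6) (q^6) / qpoch_inf q q)) UNIV"
proof -
  note q2 = norm_square_less_1[OF q(1)]
  define S where "S = qpoch_inf q (q^6) * qpoch_inf (q^5) (q^6) * qpoch_inf (q^6) (q^6) / qpoch_inf q q"
  define F :: "int \<times> int \<times> int \<Rightarrow> complex" where
    "F = (\<lambda>(i, j, k). q powi (2*i^2 + 2*j^2 + 2*k^2 + 2*i*j + 2*i*k + i + 2*k)
          * rqp (q^2) i * (rqp (q^2) j * rqp (q^2) k))"
  have "q^3 * q powi (2 * 1) = q^5" "q^3 / q powi (2 * 1) = q"
    using q by (simp_all add: power_numeral_reduce)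
  hence S: "(quad_term q 1 has_sum S) UNIV"
    using has_sum_quad_term[OF q, of 1] by (simp add: S_def mult_ac)
  define h where "h = (\<lambda>(t, m). case t of (i, j, k) \<Rightarrow> quad_term q 1 (j - m, i, k - m, m))"
  have "(h has_sum S) UNIV"
    by (rule has_sum_reindex_bij[OF S, where j = "\<lambda>((i, j, k), m). (j - m, i, k - m, m)"
          and i = "\<lambda>(x, y, b, m). ((y, x + m, b + m), m)"])
       (auto simp: h_def)
  hence "(F has_sum S) UNIV"
  proof (rule has_sum_collapse)
    fix t :: "int \<times> int \<times> int"
    obtain i j k where t: "t = (i, j, k)" by (cases t)
    have "h (t, m) = q powi (2*i^2 + 2*j^2 + 2*k^2 + 2*i*j + 2*i*k + i + 2*k) * rqp (q^2) i *
        ((q^2) powi ((j - m) * (k - m)) * rqp (q^2) m * rqp (q^2) (j - m) * rqp (q^2) (k - m))" for m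
    proof -
      have "(q^2) powi ((j - m) * (k - m)) = q powi (2 * ((j - m) * (k - m)))" by (simp add: power_int_mult)
      moreover have "q powi (2*i^2 + 2*j^2 + 2*k^2 + 2*i*j + 2*i*k + i + 2*k) * q powi (2 * ((j - m) * (k - m))) =
          q powi (((j - m) + i + (k - m) + 2 * m)^2 + 1 * ((j - m) + i + (k - m) + 2 * m) + (j - m)^2 - (j - m)
            + i^2 + (k - m)^2 + 1 * (k - m))"
        unfolding power_int_add[OF disjI1[OF q(2)], symmetric]
        by (rule arg_cong[of _ _ "\<lambda>n. q powi n"]) (simp add: power2_eq_square algebra_simps)
      ultimately show ?thesis by (simp add: h_def t quad_term_def mult_ac)
    qed
    thus "((\<lambda>m. h (t, m)) has_sum F t) UNIV"
      unfolding F_def t prod.case using q by (simp only:) (intro has_sum_cmult_right has_sum_q_vandermonde q2; simp)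
  qed
  hence "((\<lambda>(i, j, k). F (int i, int j, int k)) has_sum S) UNIV"
    by (subst (asm) has_sum_int3_support) (auto simp: F_def)
  moreover have "F (int i, int j, int k) = q ^ (2*i^2 + 2*j^2 + 2*k^2 + 2*i*j + 2*i*k + i + 2*k)
          / (qpoch (q^2) (q^2) i * qpoch (q^2) (q^2) j * qpoch (q^2) (q^2) k)" for i j k
    unfolding F_def prod.case rqp_of_nat power_int_of_nat[symmetric] by simp
  ultimately show ?thesis by (simp add: S_def)
qed

lemma has_sum_nahm_jacobi:
  assumes q: "norm q < 1" "exp L = q"
  shows "((\<lambda>(i,j,k). qpow L (real (i^2 + j^2 + k^2 + i*j + i*k) + \<nu> * (real j - real k))
          / (qpoch q q i * qpoch q q j * qpoch q q k))
       has_sum (qpoch_inf (- qpow L (1 + \<nu>)) (q^2) * qpoch_inf (- qpow L (1 - \<nu>)) (q^2)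
                * qpoch_inf (q^2) (q^2) / qpoch_inf q q)) UNIV"
proof -
  have q0: "q \<noteq> 0" using q by auto
  define z where "z = qpow L \<nu>"
  have z: "z \<noteq> 0" by (simp add: z_def qpow_def)
  have qpow_add: "qpow L (x + y) = qpow L x * qpow L y" for x y
    by (simp add: qpow_def exp_add algebra_simps)
  have qpow_1: "qpow L 1 = q" by (simp add: qpow_def q)
  have qpow_nat: "qpow L (x * real n) = qpow L x ^ n" for x n
    by (simp add: qpow_def exp_of_nat_mult[symmetric] mult_ac)
  have qpow_minus: "qpow L (- x) = 1 / qpow L x" for x
    by (simp add: qpow_def exp_minus inverse_eq_divide)
  have "qpow L (1 + \<nu>) = q * z" "qpow L (1 - \<nu>) = q / z"
    using qpow_add[of 1 \<nu>] qpow_add[of 1 "- \<nu>"] by (simp_all add: qpow_1 z_def qpow_minus)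
  moreover have "nahm_term q (1 / z) z (int i, int j, int k) =
      qpow L (real (i^2 + j^2 + k^2 + i*j + i*k) + \<nu> * (real j - real k))
          / (qpoch q q i * qpoch q q j * qpoch q q k)" for i j k
  proof -
    have "qpow L (real (i^2 + j^2 + k^2 + i*j + i*k) + \<nu> * (real j - real k)) =
        qpow L (1 * real (i^2 + j^2 + k^2 + i*j + i*k)) * (qpow L (\<nu> * real j) * qpow L (- (\<nu> * real k)))"
      unfolding qpow_add[symmetric] by (simp add: algebra_simps)
    also have "\<dots> = q ^ (i^2 + j^2 + k^2 + i*j + i*k) * (z ^ j * (1 / z ^ k))"
      unfolding qpow_minus qpow_nat qpow_1 z_def[symmetric] by simp
    also have "q ^ (i^2 + j^2 + k^2 + i*j + i*k) =
        q powi (int i^2 + int j^2 + int k^2 + int i * int j + int i * int k)"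
      unfolding power_int_of_nat[symmetric] by simp
    also have "z ^ j * (1 / z ^ k) = (1 / z) powi (int i + int k) * z powi (int i + int j)"
      using z by (simp add: power_int_add power_int_divide_distrib)
    finally show ?thesis by (simp add: nahm_term_def rqp_of_nat mult_ac)
  qed
  ultimately show ?thesis
    using has_sum_nahm_term[OF q(1) q0, of "1 / z" z] z
    by (simp add: pair_sum_theta[OF q(1) q0 z])
qed

text \<open>The recurrence at (1/q, q) gives G(1/q, q) = G(1, q) + G(q, 1), which is 2 G(1, q) by
  symmetry. The theta product at z = q contains (-1; q^2)_\<infinity> = 2 (-q^2; q^2)_\<infinity>,
  so the factor 2 cancels.\<close>

lemma has_sum_nahm_psi:
  assumes q: "norm q < 1" "q \<noteq> 0"
  shows "((\<lambda>(i,j,k). q ^ (i^2 + j^2 + k^2 + i*j + i*k + i + j)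
          / (qpoch q q i * qpoch q q j * qpoch q q k))
       has_sum (qpoch_inf (q^4) (q^4) ^ 2 / (qpoch_inf q q * qpoch_inf (q^2) (q^2)))) UNIV"
proof -
  note q2 = norm_square_less_1[OF q(1)]
  have "pair_sum q (1 / q) q = pair_sum q 1 q + pair_sum q q 1"
    using pair_sum_rec[OF q, of "1 / q" q] q by (simp add: power2_eq_square)
  also have "pair_sum q q 1 = pair_sum q 1 q" using q by (intro pair_sum_commute) auto
  finally have "2 * pair_sum q 1 q = pair_sum q (1 / q) q" by simp
  also have "\<dots> = qpoch_inf (- (q^2)) (q^2) * qpoch_inf (- 1) (q^2) * qpoch_inf (q^2) (q^2) / qpoch_inf q q"
    using q by (subst pair_sum_theta) (auto simp: power2_eq_square)
  also have "qpoch_inf (- 1) (q^2) = 2 * qpoch_inf (- (q^2)) (q^2)"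
    using qpoch_inf_rec[OF q2, of "-1"] by simp
  finally have "2 * pair_sum q 1 q = 2 * (qpoch_inf (- (q^2)) (q^2) ^ 2 * qpoch_inf (q^2) (q^2) / qpoch_inf q q)"
    by (simp add: power2_eq_square[of "qpoch_inf _ _"] mult_ac)
  hence "pair_sum q 1 q = qpoch_inf (- (q^2)) (q^2) ^ 2 * qpoch_inf (q^2) (q^2) / qpoch_inf q q"
    by (simp only: mult_cancel_left) simp
  also have "\<dots> = (qpoch_inf (q^2) (q^2) * qpoch_inf (- (q^2)) (q^2)) ^ 2 / (qpoch_inf q q * qpoch_inf (q^2) (q^2))"
    using qpoch_inf_nonzero[OF q2] by (simp add: power2_eq_square field_simps)
  also have "qpoch_inf (q^2) (q^2) * qpoch_inf (- (q^2)) (q^2) = qpoch_inf (q^4) (q^4)"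
    using qpoch_inf_mult_uminus[OF q2, of "q^2"] by simp
  finally have G: "pair_sum q 1 q = qpoch_inf (q^4) (q^4) ^ 2 / (qpoch_inf q q * qpoch_inf (q^2) (q^2))" .
  have "nahm_term q 1 q (int i, int j, int k) =
      q ^ (i^2 + j^2 + k^2 + i*j + i*k + i + j) / (qpoch q q i * qpoch q q j * qpoch q q k)" for i j k
    unfolding nahm_term_def prod.case rqp_of_nat power_int_of_nat[symmetric]
    using q by (simp add: power_int_add)
  thus ?thesis using has_sum_nahm_term[OF q, of 1 q] q by (simp add: G)
qed

text \<open>In base Q = q^2 the recurrence at (1/q, 1/q) yields G(q, 1/q) + q G(q^3, 1/q^3). Both
  summands are theta products, and they are equal; this is the source of the factor 2.\<close>

lemma has_sum_nahm_double_psi: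
  assumes q: "norm q < 1" "q \<noteq> 0"
  shows "((\<lambda>(i,j,k). q powi (2*int i^2 + 2*int j^2 + 2*int k^2 + 2*int i*int j + 2*int i*int k
                            - 2*int i - int j - int k)
          / (qpoch (q^2) (q^2) i * qpoch (q^2) (q^2) j * qpoch (q^2) (q^2) k))
       has_sum (2 * qpoch_inf (q^2) (q^2) / qpoch_inf q q)) UNIV"
proof -
  define Q where "Q = q^2"
  have Q: "norm Q < 1" "Q \<noteq> 0" using q by (auto simp: Q_def norm_square_less_1)
  have Q2: "Q^2 = q^4" by (simp add: Q_def)
  have "pair_sum Q (1 / q) (1 / q) = pair_sum Q q (1 / q) + q * pair_sum Q (q^3) (1 / q^3)"
    using pair_sum_rec[OF Q, of "1 / q" "1 / q"] q
    by (simp add: Q_def power_numeral_reduce)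
  also have "pair_sum Q q (1 / q) = qpoch_inf (- q) (q^4) * qpoch_inf (- (q^3)) (q^4) * qpoch_inf (q^4) (q^4) / qpoch_inf Q Q"
  proof -
    have "Q * (1 / q) = q" "Q / (1 / q) = q^3" using q by (simp_all add: Q_def power_numeral_reduce)
    thus ?thesis using pair_sum_theta[OF Q, of "1 / q"] q by (simp add: Q2)
  qed
  also have "q * pair_sum Q (q^3) (1 / q^3) =
      qpoch_inf (- q) (q^4) * qpoch_inf (- (q^3)) (q^4) * qpoch_inf (q^4) (q^4) / qpoch_inf Q Q"
  proof -
    have q4: "norm (q^4) < 1" using Q(1) norm_square_less_1[OF Q(1)] by (simp add: Q2)
    have Qq: "Q * (1 / q^3) = 1 / q" "Q / (1 / q^3) = q^5"
      using q by (simp_all add: Q_def power_numeral_reduce)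
    have "- (1 / q) * q^4 = - (q^3)" "- q * q^4 = - (q^5)"
      using q by (simp_all add: power_numeral_reduce)
    \<comment> \<open>Moving one factor out of each product aligns the second theta product with the
      first; the stray factors satisfy q (1 + 1/q) = 1 + q.\<close>
    hence rec: "qpoch_inf (- (1 / q)) (q^4) = (1 + 1 / q) * qpoch_inf (- (q^3)) (q^4)"
        "qpoch_inf (- q) (q^4) = (1 + q) * qpoch_inf (- (q^5)) (q^4)"
      using qpoch_inf_rec[OF q4, of "- (1 / q)"] qpoch_inf_rec[OF q4, of "- q"] by simp_all
    have "pair_sum Q (q^3) (1 / q^3) =
        qpoch_inf (- (1 / q)) (q^4) * qpoch_inf (- (q^5)) (q^4) * qpoch_inf (q^4) (q^4) / qpoch_inf Q Q"
      using pair_sum_theta[OF Q, of "1 / q^3"] q unfolding Qq Q2 by simp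
    also have "q * \<dots> = (q * (1 + 1 / q)) * (qpoch_inf (- (q^3)) (q^4) * qpoch_inf (- (q^5)) (q^4)
        * qpoch_inf (q^4) (q^4) / qpoch_inf Q Q)"
      unfolding rec by simp
    also have "q * (1 + 1 / q) = 1 + q" using q by (simp add: field_simps)
    finally show ?thesis unfolding rec by (simp add: mult_ac)
  qed
  finally have "pair_sum Q (1 / q) (1 / q) =
      2 * (qpoch_inf (- q) (q^4) * qpoch_inf (- (q^3)) (q^4) * qpoch_inf (q^4) (q^4)) / qpoch_inf Q Q"
    by simp
  also have "qpoch_inf (- q) (q^4) * qpoch_inf (- (q^3)) (q^4) = qpoch_inf (- q) Q"
    using qpoch_inf_split_parity[OF Q(1), of "- q"] by (simp add: Q2) (simp add: Q_def power_numeral_reduce)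
  also have "qpoch_inf (- q) Q * qpoch_inf (q^4) (q^4) = qpoch_inf Q Q * qpoch_inf Q Q / qpoch_inf q q"
  proof -
    have "qpoch_inf q q = qpoch_inf q Q * qpoch_inf Q Q"
      using qpoch_inf_split_parity[OF q(1), of q] by (simp add: Q_def power2_eq_square)
    moreover have "qpoch_inf q Q * qpoch_inf (- q) Q = qpoch_inf Q (q^4)"
      using qpoch_inf_mult_uminus[OF Q(1), of q] by (simp add: Q2 flip: Q_def)
    moreover have "qpoch_inf Q Q = qpoch_inf Q (q^4) * qpoch_inf (q^4) (q^4)"
      using qpoch_inf_split_parity[OF Q(1), of Q] by (simp add: Q2 power2_eq_square[symmetric])
    ultimately have "(qpoch_inf (- q) Q * qpoch_inf (q^4) (q^4)) * qpoch_inf q q = qpoch_inf Q Q * qpoch_inf Q Q"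
      by (simp add: mult_ac)
    thus ?thesis using qpoch_inf_nonzero[OF q(1)] by (simp add: field_simps)
  qed
  finally have G: "pair_sum Q (1 / q) (1 / q) = 2 * qpoch_inf Q Q / qpoch_inf q q"
    using qpoch_inf_nonzero[OF Q(1)] by simp
  have "nahm_term Q (1 / q) (1 / q) (int i, int j, int k) =
      q powi (2*int i^2 + 2*int j^2 + 2*int k^2 + 2*int i*int j + 2*int i*int k - 2*int i - int j - int k)
          / (qpoch Q Q i * qpoch Q Q j * qpoch Q Q k)" for i j k
  proof -
    have "Q powi (int i^2 + int j^2 + int k^2 + int i * int j + int i * int k) =
            q powi (2 * (int i^2 + int j^2 + int k^2 + int i * int j + int i * int k))"
      unfolding Q_def by (subst power_int_mult) simp
    moreover have "(1 / q) powi n = q powi (- n)" for n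
      by (simp add: power_int_divide_distrib power_int_minus inverse_eq_divide)
    moreover have "q powi (2 * (int i^2 + int j^2 + int k^2 + int i * int j + int i * int k))
        * q powi (- (int i + int k)) * q powi (- (int i + int j)) =
      q powi (2*int i^2 + 2*int j^2 + 2*int k^2 + 2*int i*int j + 2*int i*int k - 2*int i - int j - int k)"
      unfolding power_int_add[OF disjI1[OF q(2)], symmetric]
      by (rule arg_cong[of _ _ "\<lambda>n. q powi n"]) (simp add: algebra_simps)
    ultimately show ?thesis by (simp add: nahm_term_def rqp_of_nat)
  qed
  thus ?thesis using has_sum_nahm_term[OF Q, of "1 / q" "1 / q"] q unfolding G by (simp add: Q_def)
qed

section \<open>Conclusion, including the degenerate case q = 0\<close>

lemma qpoch_at_0 [simp]: "qpoch 0 0 n = 1"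
  by (simp add: qpoch_def)

lemma qpoch_inf_at_0 [simp]: "qpoch_inf 0 0 = 1"
  by (simp add: qpoch_inf_def)

theorem theorem4p7:
  fixes q :: complex
  assumes "norm q < 1"
  shows
   "(\<forall>L (\<nu>::real). exp L = q \<longrightarrow>
      ((\<lambda>(i,j,k). qpow L (real (i^2 + j^2 + k^2 + i*j + i*k) + \<nu> * (real j - real k))
          / (qpoch q q i * qpoch q q j * qpoch q q k))
       has_sum (qpoch_inf (- qpow L (1 + \<nu>)) (q^2) * qpoch_inf (- qpow L (1 - \<nu>)) (q^2)
                * qpoch_inf (q^2) (q^2) / qpoch_inf q q)) (UNIV :: (nat \<times> nat \<times> nat) set))
    \<and> ((\<lambda>(i,j,k). q ^ (i^2 + j^2 + k^2 + i*j + i*k + i + j)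
          / (qpoch q q i * qpoch q q j * qpoch q q k))
       has_sum (qpoch_inf (q^4) (q^4) ^ 2 / (qpoch_inf q q * qpoch_inf (q^2) (q^2))))
       (UNIV :: (nat \<times> nat \<times> nat) set)
    \<and> ((\<lambda>(i,j,k). q ^ (2*i^2 + 2*j^2 + 2*k^2 + 2*i*j + 2*i*k + i + 2*k)
          / (qpoch (q^2) (q^2) i * qpoch (q^2) (q^2) j * qpoch (q^2) (q^2) k))
       has_sum (qpoch_inf q (q^6) * qpoch_inf (q^5) (q^6) * qpoch_inf (q^6) (q^6) / qpoch_inf q q))
       (UNIV :: (nat \<times> nat \<times> nat) set)
    \<and> ((\<lambda>(i,j,k). q powi (2*int i^2 + 2*int j^2 + 2*int k^2 + 2*int i*int j + 2*int i*int k - int i)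
          / (qpoch (q^2) (q^2) i * qpoch (q^2) (q^2) j * qpoch (q^2) (q^2) k))
       has_sum (qpoch_inf (q^3) (q^3) ^ 2 / (qpoch_inf q q * qpoch_inf (q^6) (q^6))))
       (UNIV :: (nat \<times> nat \<times> nat) set)
    \<and> ((\<lambda>(i,j,k). q powi (2*int i^2 + 2*int j^2 + 2*int k^2 + 2*int i*int j + 2*int i*int k
                            - 2*int i - int j - int k)
          / (qpoch (q^2) (q^2) i * qpoch (q^2) (q^2) j * qpoch (q^2) (q^2) k))
       has_sum (2 * qpoch_inf (q^2) (q^2) / qpoch_inf q q))
       (UNIV :: (nat \<times> nat \<times> nat) set)"
proof (cases "q = 0")
  case False
  with assms show ?thesis
    by (intro conjI allI impI has_sum_nahm_jacobi has_sum_nahm_psi has_sum_nahm_theta_one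
          has_sum_nahm_theta_zero has_sum_nahm_double_psi) auto
next
  case True
  \<comment> \<open>For q = 0 no L satisfies exp L = q, which settles the first identity. In the
    others 0^0 = 1 and all other powers vanish, so only indices with exponent zero
    contribute.\<close>
  have sq: "x \<le> x^2" if "x \<ge> 0" for x :: int
    using that self_le_power[of x 2] by (cases "x = 0") auto
  have nz4: "2*int i^2 + 2*int j^2 + 2*int k^2 + 2*int i*int j + 2*int i*int k - int i \<noteq> 0"
    if "(i, j, k) \<noteq> (0, 0, 0)" for i j k
  proof -
    have "0 \<le> int i * int j" "0 \<le> int i * int k" by simp_all
    moreover have "0 < int i + int j + int k" using that by auto
    ultimately show ?thesis using sq[of "int i"] sq[of "int j"] sq[of "int k"] by linarith
  qed
  \<comment> \<open>The exponent also vanishes at (1, 0, 0); this second term of value 1 matches the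
    factor 2 on the right-hand side.\<close>
  have nz5: "2*int i^2 + 2*int j^2 + 2*int k^2 + 2*int i*int j + 2*int i*int k - 2*int i - int j - int k \<noteq> 0"
    if "(i, j, k) \<notin> {(0, 0, 0), (1, 0, 0)}" for i j k
  proof -
    have ij: "0 \<le> int i * int j" "0 \<le> int i * int k" by simp_all
    show ?thesis
    proof (cases "j = 0 \<and> k = 0")
      case True
      hence "i \<ge> 2" using that by (cases i; cases "i - 1") auto
      hence "2 * int i \<le> int i * int i" by (intro mult_right_mono) auto
      with True \<open>i \<ge> 2\<close> show ?thesis by (auto simp: power2_eq_square)
    next
      case False
      hence "0 < int j + int k" by auto
      thus ?thesis using ij sq[of "int i"] sq[of "int j"] sq[of "int k"] by linarith
    qed
  qed
  have zero4: "(0 :: complex) powi (2*int i^2 + 2*int j^2 + 2*int k^2 + 2*int i*int j + 2*int i*int k - int i) = 0"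
    if "(i, j, k) \<noteq> (0, 0, 0)" for i j k
    using nz4[OF that] by (simp only: power_int_0_left_if if_False)
  have zero5: "(0 :: complex) powi (2*int i^2 + 2*int j^2 + 2*int k^2 + 2*int i*int j + 2*int i*int k
      - 2*int i - int j - int k) = 0" if "(i, j, k) \<notin> {(0, 0, 0), (1, 0, 0)}" for i j k
    using nz5[OF that] by (simp only: power_int_0_left_if if_False)
  show ?thesis
  proof (intro conjI, goal_cases)
    case 1
    thus ?case using True by auto
  next
    case 2
    thus ?case
      using True by (intro has_sum_finite_neutralI[of "{(0, 0, 0)}"]) (auto simp: power_0_left split: if_splits)
  next
    case 3
    thus ?case
      using True by (intro has_sum_finite_neutralI[of "{(0, 0, 0)}"]) (auto simp: power_0_left split: if_splits)
  next
    case 4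
    show ?case
    proof (intro has_sum_finite_neutralI[of "{(0, 0, 0)}"], goal_cases)
      case (3 x)
      thus ?case using True zero4 by (cases x) (simp only: prod.case, auto)
    qed (use True in auto)
  next
    case 5
    show ?case
    proof (intro has_sum_finite_neutralI[of "{(0, 0, 0), (1, 0, 0)}"], goal_cases)
      case (3 x)
      thus ?case using True zero5 by (cases x) (simp only: prod.case, auto)
    qed (use True in auto)
  qed
qed

end
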